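(* Let $m$ be a positive integer and $h>0$ the step of the lattice. Let $\lambda_k$, $k=1,\dots,m-1$, be the roots of the Euler polynomial $E_{2m-2}(\lambda)$ with $|\lambda_k|<1$. Then the discrete analogue $D_m[\beta]$ of the differential operator $\frac{d^{2m}}{dx^{2m}}$ of order $2m$ has the representation $$ D_m[\beta]=\frac{(2m-1)!}{h^{2m}}\,\Delta_2^{[m]}[\beta]*\sum_{k=1}^{m-1}\frac{\lambda_k^{|\beta|+m-2}}{E_{2m-2}'(\lambda_k)}, $$ where $$ \Delta_2^{[m]}[\beta]=\sum_{k=-m}^{m}(-1)^{k+m}\binom{2m}{m+k}\delta[\beta-k] $$ is the symmetric difference of order $2m$.
   Context: Euler polynomials: for an integer $k\ge 0$, $E_k(\lambda)$ is the polynomial of degree $k$ defined by $\lambda E_k(\lambda)=(1-\lambda)^{k+2}D^k\frac{\lambda}{(1-\lambda)^2}$, where $D=\lambda\frac{d}{d\lambda}$ and $D^k=\lambda\frac{d}{d\lambda}D^{k-1}$ (e.g. $E_0=1$, $E_1=\lambda+1$, $E_2=\lambda^2+4\lambda+1$). It is known (Frobenius) that all $k$ roots of $E_k$ are real, negative and distinct, $\lambda_1^{(k)}<\dots<\lambda_k^{(k)}<0$, and that $\lambda_j^{(k)}\lambda_{k+1-j}^{(k)}=1$; hence $E_{2m-2}$ has exactly $m-1$ roots of modulus less than $1$. $E_{2m-2}'$ denotes the derivative in $\lambda$. Functions of discrete argument are functions of $\beta\in\mathbb{Z}$. Put $G_m[\beta]=\frac{(h\beta)^{2m-1}\operatorname{sign}(h\beta)}{2\,(2m-1)!}$,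 and $\delta[\beta]=1$ if $\beta=0$, $\delta[\beta]=0$ otherwise. Convolution is $\varphi[\beta]*\psi[\beta]=\sum_{\gamma\in\mathbb{Z}}\varphi[\gamma]\psi[\beta-\gamma]$. The discrete analogue $D_m[\beta]$ of $d^{2m}/dx^{2m}$ is the function of discrete argument satisfying $h\,D_m[\beta]*G_m[\beta]=\delta[\beta]$, obtained by Fourier transformation: the $D_m[\beta]$ are the coefficients of the Fourier series $$\sum_{\beta}D_m[\beta]\exp(2\pi i h\beta p)=\left[\frac{(-1)^m}{(2\pi)^{2m}}\sum_{\beta}\frac{1}{|p-h^{-1}\beta|^{2m}}\right]^{-1},$$ whose right-hand side is a function of real $p$, periodic with period $h^{-1}$ and analytic (with zeros at $p=h^{-1}\beta$).
   Formalization: The formal theorem assumes m ≥ 2: for m = 1 the Euler polynomial E_0 = 1 has no roots, so the stated right-hand side is 0, whereas D_1[β] = h^{-2}(δ[β+1] − 2δ[β] + δ[β−1]) is not zero. *)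

theory Defs
  imports "HOL-Analysis.Analysis" "HOL-Computational_Algebra.Polynomial"
begin

definition theta_op :: "(complex \<Rightarrow> complex) \<Rightarrow> complex \<Rightarrow> complex" where
  "theta_op f = (\<lambda>z. z * deriv f z)"

definition euler_poly :: "nat \<Rightarrow> complex poly" where
  "euler_poly k = (THE p. \<forall>z. z \<noteq> 1 \<longrightarrow>
     z * poly p z = (1 - z) ^ (k + 2) * (theta_op ^^ k) (\<lambda>w. w / (1 - w)\<^sup>2) z)"

definition conv :: "(int \<Rightarrow> complex) \<Rightarrow> (int \<Rightarrow> complex) \<Rightarrow> int \<Rightarrow> complex" where
  "conv \<phi> \<psi> \<beta> = (\<Sum>\<^sub>\<infinity>\<gamma>\<in>UNIV. \<phi> \<gamma> * \<psi> (\<beta> - \<gamma>))"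

definition delta :: "int \<Rightarrow> complex" where
  "delta \<beta> = (if \<beta> = 0 then 1 else 0)"

definition G :: "nat \<Rightarrow> real \<Rightarrow> int \<Rightarrow> complex" where
  "G m h \<beta> = of_real
     ((h * of_int \<beta>) ^ (2 * m - 1) * sgn (h * of_int \<beta>) / (2 * fact (2 * m - 1)))"

(* The lattice points p = \<beta>/h are poles of the inner sum.  The reciprocal extends
   analytically by 0 there; the convention 1/0 = 0 would give a different value. *)
definition symbol :: "nat \<Rightarrow> real \<Rightarrow> real \<Rightarrow> real" where
  "symbol m h p = (if \<exists>\<beta>::int. p = of_int \<beta> / h then 0
     else inverse ((-1) ^ m / (2 * pi) ^ (2 * m) *
            (\<Sum>\<^sub>\<infinity>\<beta>\<in>(UNIV::int set). 1 / \<bar>p - of_int \<beta> / h\<bar> ^ (2 * m))))"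

(* The convolution equation is required together with the Fourier expansion.  Its
   summability clause is explicit because infsum is 0 for non-summable families. *)
definition is_discrete_analogue :: "nat \<Rightarrow> real \<Rightarrow> (int \<Rightarrow> complex) \<Rightarrow> bool" where
  "is_discrete_analogue m h D \<longleftrightarrow>
     (\<forall>\<beta>. (\<lambda>\<gamma>. D \<gamma> * G m h (\<beta> - \<gamma>)) summable_on UNIV) \<and>
     (\<forall>\<beta>. of_real h * conv D (G m h) \<beta> = delta \<beta>) \<and>
     (\<forall>p::real. ((\<lambda>\<beta>. D \<beta> * exp (2 * of_real pi * \<i> * of_real h * of_int \<beta> * of_real p))
        has_sum of_real (symbol m h p)) UNIV)"

(* For m = 1 this is (\<delta>[\<beta>+1] - 2 \<delta>[\<beta>] + \<delta>[\<beta>-1]) / h^2, while a sum over the roots of E_0 = 1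
   is empty; representations by the roots of E_{2m-2} therefore need m \<ge> 2. *)
definition discrete_analogue :: "nat \<Rightarrow> real \<Rightarrow> int \<Rightarrow> complex" where
  "discrete_analogue m h = (THE D. is_discrete_analogue m h D)"

definition sym_diff2 :: "nat \<Rightarrow> int \<Rightarrow> complex" where
  "sym_diff2 m \<beta> = (\<Sum>k = - int m..int m.
     (-1) ^ nat (k + int m) * of_nat ((2 * m) choose nat (int m + k)) * delta (\<beta> - k))"

end

theory Submission
  imports Defs "HOL-Computational_Algebra.Polynomial_FPS"
begin

text \<open>
  Put $w = e^{2\pi i h p}$. Differentiating the reflection formula of the digamma function $2m-1$
  times gives
  $\sum_\beta (x-\beta)^{-2m} = (2\pi i)^{2m}\,w E_{2m-2}(w) / ((2m-1)!\,(1-w)^{2m})$ for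
  $w = e^{2\pi i x}$, so the prescribed Fourier series equals
  $\frac{(2m-1)!}{h^{2m}}\,\frac{(1-w)^{2m}}{w E_{2m-2}(w)}$. The factor $(1-w)^{2m} w^{-m}$ is the
  symbol of the symmetric difference. Since $E_{2m-2}$ is palindromic of degree $2m-2$, the $m-1$
  given roots and their inverses are all its roots and are simple; expanding $w^{m-1}/E_{2m-2}(w)$
  into partial fractions and geometric series yields the sum over $\lambda_k^{|\beta|+m-2}$.

  The convolution equation needs no separate inversion: the difference of order $2m$ of $G_m$ is the
  sequence of coefficients of $E_{2m-2}$ up to a factor, and convolving these coefficients with the
  expansion of $w^{m-1}/E_{2m-2}(w)$ gives $\delta$ by uniqueness of Fourier coefficients.
\<close>

subsection \<open>Euler polynomials\<close>

text \<open>The recurrence is what the quotient rule does to the numerator p of z p / (1 - z)^(k+2)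
  under one application of z d/dz. The coefficients are the Eulerian numbers.\<close>

primrec eulerian :: "nat \<Rightarrow> complex poly" where
  "eulerian 0 = 1"
| "eulerian (Suc k) = [:1, of_nat (Suc k):] * eulerian k + [:0, 1, - 1:] * pderiv (eulerian k)"

text \<open>One step of \<open>theta_op\<close> with its outer factor left off. As a bare derivative
  it also fits the chain rule with w = exp(2 pi i z) in \<open>Polygamma_reflection\<close>.\<close>

lemma theta_op_eulerian_step:
  assumes "z \<noteq> 1"
  shows "((\<lambda>w. w * poly (eulerian k) w / (1 - w) ^ (k + 2)) has_field_derivative
           poly (eulerian (Suc k)) z / (1 - z) ^ (Suc k + 2)) (at z)"
proof -
  have nz: "1 - z \<noteq> 0"
    using assms by simp
  have "((\<lambda>w. 1 - w) has_field_derivative - 1) (at z)"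
    by (auto intro!: derivative_eq_intros)
  from DERIV_power[OF this, of "k + 2"]
  have "((\<lambda>w. (1 - w) ^ (k + 2)) has_field_derivative of_nat (k + 2) * (1 - z) ^ (k + 1) * (- 1)) (at z)"
    by simp
  moreover have "((\<lambda>w. w * poly (eulerian k) w) has_field_derivative
      poly (eulerian k) z + z * poly (pderiv (eulerian k)) z) (at z)"
    by (auto intro!: derivative_eq_intros)
  ultimately have "((\<lambda>w. w * poly (eulerian k) w / (1 - w) ^ (k + 2)) has_field_derivative
          ((poly (eulerian k) z + z * poly (pderiv (eulerian k)) z) * (1 - z) ^ (k + 2)
            - z * poly (eulerian k) z * (of_nat (k + 2) * (1 - z) ^ (k + 1) * (- 1)))
          / ((1 - z) ^ (k + 2) * (1 - z) ^ (k + 2))) (at z)"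
    using nz by (intro DERIV_divide) auto
  also have "((poly (eulerian k) z + z * poly (pderiv (eulerian k)) z) * (1 - z) ^ (k + 2)
            - z * poly (eulerian k) z * (of_nat (k + 2) * (1 - z) ^ (k + 1) * (- 1)))
     = (1 - z) ^ (k + 1) * poly (eulerian (Suc k)) z"
    by (simp add: algebra_simps)
  also have "(1 - z) ^ (k + 1) * poly (eulerian (Suc k)) z / ((1 - z) ^ (k + 2) * (1 - z) ^ (k + 2))
     = poly (eulerian (Suc k)) z / (1 - z) ^ (Suc k + 2)"
    using nz by (simp add: divide_simps)
  finally show ?thesis .
qed

lemma theta_op_funpow_eq:
  assumes "z \<noteq> 1"
  shows "(theta_op ^^ k) (\<lambda>w. w / (1 - w)\<^sup>2) z = z * poly (eulerian k) z / (1 - z) ^ (k + 2)"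
  using assms
proof (induction k arbitrary: z)
  case 0
  then show ?case by (simp add: power2_eq_square)
next
  case (Suc k)
  have "((theta_op ^^ k) (\<lambda>w. w / (1 - w)\<^sup>2) has_field_derivative
          poly (eulerian (Suc k)) z / (1 - z) ^ (Suc k + 2)) (at z)"
    \<comment> \<open>The closed form of the previous iterate is known only away from 1, so its
      derivative is transferred on the open set \<open>- {1}\<close>.\<close>
    by (rule has_field_derivative_transform_within_open[OF theta_op_eulerian_step[OF Suc.prems],
          of "- {1}"]) (use Suc in auto)
  then have "deriv ((theta_op ^^ k) (\<lambda>w. w / (1 - w)\<^sup>2)) z
      = poly (eulerian (Suc k)) z / (1 - z) ^ (Suc k + 2)"
    by (rule DERIV_imp_deriv)
  then show ?case
    by (simp add: theta_op_def[of "(theta_op ^^ k) _"] del: eulerian.simps)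
qed

lemma poly_eqI_infinite:
  fixes p q :: "'a::idom poly"
  assumes "infinite A" and "\<And>x. x \<in> A \<Longrightarrow> poly p x = poly q x"
  shows "p = q"
proof (rule ccontr)
  assume "p \<noteq> q"
  then have "finite {x. poly (p - q) x = 0}"
    by (intro poly_roots_finite) simp
  moreover have "A \<subseteq> {x. poly (p - q) x = 0}"
    using assms(2) by auto
  ultimately show False
    using assms(1) finite_subset by blast
qed

text \<open>The description by \<open>THE\<close> is meaningful: the defining identity fixes
  \<open>poly p z\<close> for every z except 0 and 1, hence at infinitely many points.\<close>

lemma euler_poly_eq_eulerian: "euler_poly k = eulerian k"
  unfolding euler_poly_def
proof (rule the_equality)
  show "\<forall>z. z \<noteq> 1 \<longrightarrow> z * poly (eulerian k) z =
          (1 - z) ^ (k + 2) * (theta_op ^^ k) (\<lambda>w. w / (1 - w)\<^sup>2) z"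
    by (simp add: theta_op_funpow_eq)
next
  fix p
  assume p: "\<forall>z. z \<noteq> 1 \<longrightarrow> z * poly p z =
          (1 - z) ^ (k + 2) * (theta_op ^^ k) (\<lambda>w. w / (1 - w)\<^sup>2) z"
  show "p = eulerian k"
  proof (rule poly_eqI_infinite[of "UNIV - {0, 1}"])
    show "infinite (UNIV - {0, 1 :: complex})"
      by (simp add: infinite_UNIV_char_0)
    fix z :: complex assume "z \<in> UNIV - {0, 1}"
    then show "poly p z = poly (eulerian k) z"
      using p theta_op_funpow_eq[of z k] by auto
  qed
qed

section \<open>Coefficients of the Euler polynomials: triangle recurrence, degree, symmetry\<close>

lemma coeff_eulerian_Suc:
  "coeff (eulerian (Suc k)) j = of_nat (Suc j) * coeff (eulerian k) j +
     (if j = 0 then 0 else (of_nat (k + 2) - of_nat j) * coeff (eulerian k) (j - 1))"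
proof -
  have "[:0, 1, - 1:] * pderiv (eulerian k) = pCons 0 (pderiv (eulerian k) - pCons 0 (pderiv (eulerian k)))"
    by (simp add: algebra_simps)
  then show ?thesis
    by (cases j; cases "j - 1")
      (auto simp: coeff_pCons coeff_pderiv algebra_simps split: nat.split)
qed

lemma coeff_eulerian_eq_0: "j > k \<Longrightarrow> coeff (eulerian k) j = 0"
proof (induction k arbitrary: j)
  case (Suc k)
  then show ?case
  proof (cases "j = k + 2")
    case False
    then have "j - 1 > k" "j > k" using Suc.prems by auto
    then show ?thesis unfolding coeff_eulerian_Suc by (simp add: Suc.IH)
  qed (simp add: coeff_eulerian_Suc Suc.IH del: eulerian.simps)
qed simp

text \<open>Under j -> k + 1 - j the weights j + 1 and k + 2 - j of the recurrence change places,
  and by induction so do the coefficients they multiply.\<close>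

lemma coeff_eulerian_symmetric: "j \<le> k \<Longrightarrow> coeff (eulerian k) (k - j) = coeff (eulerian k) j"
proof (induction k arbitrary: j)
  case (Suc k)
  show ?case
  proof (cases "j = 0 \<or> j = Suc k")
    case True
    then show ?thesis
      using Suc.IH[of 0] by (auto simp: coeff_eulerian_Suc coeff_eulerian_eq_0 simp del: eulerian.simps)
  next
    case False
    then have j: "0 < j" "j \<le> k" using Suc.prems by auto
    have "coeff (eulerian k) (k - (j - 1)) = coeff (eulerian k) (j - 1)"
      using j by (intro Suc.IH) auto
    moreover have "coeff (eulerian k) (k - j) = coeff (eulerian k) j"
      using j by (intro Suc.IH) auto
    moreover have "k - (j - 1) = Suc k - j" "Suc k - j - 1 = k - j" using j by auto
    ultimately show ?thesis
      using j unfolding coeff_eulerian_Suc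
      by (simp add: of_nat_diff algebra_simps)
  qed
qed simp

lemma coeff_eulerian_0 [simp]: "coeff (eulerian k) 0 = 1"
  by (induction k) (auto simp: coeff_eulerian_Suc simp del: eulerian.simps(2))

lemma coeff_eulerian_lead: "coeff (eulerian k) k = 1"
  using coeff_eulerian_symmetric[of 0 k] by simp

lemma degree_eulerian [simp]: "degree (eulerian k) = k"
  by (intro antisym degree_le le_degree) (auto simp: coeff_eulerian_eq_0 coeff_eulerian_lead)

lemma reflect_eulerian: "reflect_poly (eulerian k) = eulerian k"
  by (rule poly_eqI) (auto simp: coeff_reflect_poly coeff_eulerian_eq_0 coeff_eulerian_symmetric)

text \<open>Palindromicity in functional form. It pairs each root with its inverse, and its
  derivative relates the derivatives at the two.\<close>

lemma poly_eulerian_inverse: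
  "z \<noteq> 0 \<Longrightarrow> poly (eulerian k) z = z ^ k * poly (eulerian k) (inverse z)"
  using poly_reflect_poly_nz[of z "eulerian k"] by (simp add: reflect_eulerian)

text \<open>The formal counterpart of the definition: z / (1 - z)^2 is the series of n z^n, and each
  z d/dz multiplies the n-th coefficient by n. It later evaluates differences of truncated
  powers.\<close>

lemma fps_eulerian:
  "fps_X * fps_of_poly (eulerian k) = (1 - fps_X) ^ (k + 2) * Abs_fps (\<lambda>n. of_nat n ^ Suc k)"
proof (induction k)
  case 0
  show ?case
  proof (rule fps_ext)
    fix n
    have "(1 - fps_X) ^ (0 + 2) * Abs_fps (\<lambda>n. of_nat n ^ Suc 0 :: complex) =
       (let F = Abs_fps (\<lambda>n. of_nat n ^ Suc 0) in F - fps_X * F - fps_X * F + fps_X * (fps_X * F))"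
      by (simp add: Let_def algebra_simps power2_eq_square)
    then show "fps_nth (fps_X * fps_of_poly (eulerian 0)) n =
        fps_nth ((1 - fps_X) ^ (0 + 2) * Abs_fps (\<lambda>n. of_nat n ^ Suc 0)) n"
      by (auto simp: Let_def fps_X_nth of_nat_diff)
  qed
next
  case (Suc k)
  define F where "F = (\<lambda>k. Abs_fps (\<lambda>n. of_nat n ^ Suc k :: complex))"
  define p where "p = fps_of_poly (eulerian k)"
  have F_Suc: "F (Suc k) = fps_X * fps_deriv (F k)"
    by (rule fps_ext) (simp add: F_def)
  have IH: "fps_X * p = (1 - fps_X) ^ (k + 2) * F k"
    using Suc by (simp add: F_def p_def)
  have "fps_deriv (fps_X * p) = (1 - fps_X) ^ (k + 2) * fps_deriv (F k)
          - of_nat (k + 2) * (1 - fps_X) ^ (k + 1) * F k"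
  proof -
    have "fps_deriv ((1 - fps_X) ^ (k + 2)) = - (of_nat (k + 2) * (1 - fps_X) ^ (k + 1) :: complex fps)"
      by (subst fps_deriv_power) (simp add: fps_of_nat[symmetric] smult_diff_left smult_add_left algebra_simps del: power_Suc)
    then show ?thesis unfolding IH fps_deriv_mult by simp
  qed
  \<comment> \<open>Multiplying by (1 - X) X raises the exponent to that of the next case and turns
    the derivative of \<open>F k\<close> into \<open>F (Suc k)\<close>.\<close>
  then have "(1 - fps_X) * (fps_X * fps_deriv (fps_X * p)) = (1 - fps_X) * (fps_X *
      ((1 - fps_X) ^ (k + 2) * fps_deriv (F k) - of_nat (k + 2) * (1 - fps_X) ^ (k + 1) * F k))"
    by (simp only:)
  also have "\<dots> = (1 - fps_X) ^ (Suc k + 2) * F (Suc k)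
          - of_nat (k + 2) * fps_X * ((1 - fps_X) ^ (k + 2) * F k)"
    unfolding F_Suc by (simp add: algebra_simps)
  finally have "(1 - fps_X) ^ (Suc k + 2) * F (Suc k) =
      fps_X * ((1 - fps_X) * fps_deriv (fps_X * p) + of_nat (k + 2) * (fps_X * p))"
    unfolding IH[symmetric] by (simp add: algebra_simps)
  also have "(1 - fps_X) * fps_deriv (fps_X * p) + of_nat (k + 2) * (fps_X * p)
      = fps_of_poly (eulerian (Suc k))"
  proof -
    have *: "fps_of_poly [:1, of_nat (Suc k):] = 1 + of_nat (Suc k) * fps_X"
            "fps_of_poly [:0, 1, - 1 :: complex:] = fps_X * (1 - fps_X)"
      by (simp_all add: fps_of_poly_pCons algebra_simps flip: fps_of_nat)
    show ?thesis
      unfolding eulerian.simps fps_of_poly_add fps_of_poly_mult * fps_of_poly_pderiv p_def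
      by (simp add: algebra_simps)
  qed
  finally show ?case by (simp add: F_def)
qed

subsection \<open>Sums over the integers\<close>

lemma has_sum_int_split:
  fixes f :: "int \<Rightarrow> 'a::{topological_ab_group_add}"
  assumes "((\<lambda>n. f (int n)) has_sum a) UNIV" and "((\<lambda>n. f (- int (Suc n))) has_sum b) UNIV"
  shows "(f has_sum (a + b)) UNIV"
proof -
  have "(f has_sum a) {0..}"
    using assms(1)
    by (subst has_sum_reindex_bij_witness[of _ int nat UNIV "\<lambda>n. f (int n)" f a]) auto
  moreover have "(f has_sum b) {..<0}"
    using assms(2)
    by (subst has_sum_reindex_bij_witness[of _ "\<lambda>n. - int (Suc n)" "\<lambda>i. nat (- i - 1)" UNIV
          "\<lambda>n. f (- int (Suc n))" f b]) auto
  ultimately have "(f has_sum (a + b)) ({0..} \<union> {..<0})"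
    by (rule has_sum_Un_disjoint) auto
  also have "{0..} \<union> {..<0} = (UNIV :: int set)"
    by auto
  finally show ?thesis .
qed

lemma has_sum_int_shift:
  fixes f :: "int \<Rightarrow> 'a::{topological_comm_monoid_add,t2_space}"
  shows "((\<lambda>\<gamma>. f (\<gamma> + k)) has_sum s) UNIV \<longleftrightarrow> (f has_sum s) UNIV"
  by (rule has_sum_reindex_bij_witness[of _ "\<lambda>\<gamma>. \<gamma> - k" "\<lambda>\<gamma>. \<gamma> + k"]) auto

lemma has_sum_int_reflect:
  fixes f :: "int \<Rightarrow> 'a::{topological_comm_monoid_add,t2_space}"
  shows "((\<lambda>\<gamma>. f (k - \<gamma>)) has_sum s) UNIV \<longleftrightarrow> (f has_sum s) UNIV"
  by (rule has_sum_reindex_bij_witness[of _ "\<lambda>\<gamma>. k - \<gamma>" "\<lambda>\<gamma>. k - \<gamma>"]) auto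

lemma has_sum_sum:
  fixes f :: "'b \<Rightarrow> 'c \<Rightarrow> 'a::topological_comm_monoid_add"
  assumes "finite K" and "\<And>k. k \<in> K \<Longrightarrow> (f k has_sum s k) A"
  shows "((\<lambda>x. \<Sum>k\<in>K. f k x) has_sum (\<Sum>k\<in>K. s k)) A"
  using assms by (induction K rule: finite_induct) (auto intro!: has_sum_add)

lemma summable_on_sum:
  fixes f :: "'b \<Rightarrow> 'c \<Rightarrow> 'a::topological_comm_monoid_add"
  assumes "finite K" and "\<And>k. k \<in> K \<Longrightarrow> f k summable_on A"
  shows "(\<lambda>x. \<Sum>k\<in>K. f k x) summable_on A"
  using assms by (induction K rule: finite_induct) (auto intro!: summable_on_add)

text \<open>Nonnegative indices give a geometric series in \<open>l * z\<close>, negative ones a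
  series in \<open>l / z\<close>. For nonzero \<open>l\<close> the sum has its poles at
  \<open>l\<close> and \<open>1 / l\<close>, the shape in which the partial fractions of inverse
  root pairs appear.\<close>

lemma has_sum_geometric_int:
  fixes l z :: complex
  assumes l: "norm l < 1" and z: "norm z = 1"
  shows "((\<lambda>\<gamma>. l ^ nat \<bar>\<gamma>\<bar> * z powi \<gamma>) has_sum ((1 - l\<^sup>2) * z / ((1 - l * z) * (z - l)))) UNIV"
proof -
  have nz: "z \<noteq> 0" "1 - l * z \<noteq> 0" "z - l \<noteq> 0" "1 - l / z \<noteq> 0"
  proof -
    show "z \<noteq> 0" "z - l \<noteq> 0" using l z by auto
    then show "1 - l / z \<noteq> 0" by simp
    have "norm (l * z) < 1" using l z by (simp add: norm_mult)
    then show "1 - l * z \<noteq> 0" by force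
  qed
  have 1: "((\<lambda>n. l ^ nat \<bar>int n\<bar> * z powi int n) has_sum (1 / (1 - l * z))) UNIV"
  proof (rule norm_summable_imp_has_sum)
    show "(\<lambda>n. l ^ nat \<bar>int n\<bar> * z powi int n) sums (1 / (1 - l * z))"
      using geometric_sums[of "l * z"] l z by (simp add: norm_mult power_mult_distrib)
    show "summable (\<lambda>n. norm (l ^ nat \<bar>int n\<bar> * z powi int n))"
      using l z by (simp add: norm_mult norm_power summable_geometric)
  qed
  have eq: "l ^ nat \<bar>- int (Suc n)\<bar> * z powi (- int (Suc n)) = (l / z) * (l / z) ^ n" for n
  proof -
    have "z powi (- int (Suc n)) = inverse (z ^ Suc n)"
      by (simp add: power_int_minus del: of_nat_Suc)
    moreover have "nat \<bar>- int (Suc n)\<bar> = Suc n" by simp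
    ultimately show ?thesis using nz by (simp add: field_simps)
  qed
  have 2: "((\<lambda>n. l ^ nat \<bar>- int (Suc n)\<bar> * z powi (- int (Suc n))) has_sum (l / z * (1 / (1 - l / z)))) UNIV"
    unfolding eq
  proof (rule norm_summable_imp_has_sum)
    show "(\<lambda>n. l / z * (l / z) ^ n) sums (l / z * (1 / (1 - l / z)))"
      using l z by (intro sums_mult geometric_sums) (simp add: norm_divide)
    show "summable (\<lambda>n. norm (l / z * (l / z) ^ n))"
      using l z by (auto simp add: norm_mult norm_power norm_divide intro!: summable_mult summable_geometric)
  qed
  have "1 / (1 - l * z) + l / z * (1 / (1 - l / z)) = (1 - l\<^sup>2) * z / ((1 - l * z) * (z - l))"
  proof -
    have "l / z * (1 / (1 - l / z)) = l / (z - l)"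
      using nz by (simp add: field_simps)
    also have "1 / (1 - l * z) + \<dots> = (1 - l\<^sup>2) * z / ((1 - l * z) * (z - l))"
      using nz by (simp add: add_frac_eq) (simp add: algebra_simps power2_eq_square)
    finally show ?thesis .
  qed
  with has_sum_int_split[OF 1 2] show ?thesis by simp
qed

lemma summable_geometric_int:
  fixes q :: real
  assumes "0 \<le> q" "q < 1"
  shows "(\<lambda>\<gamma>::int. q ^ nat \<bar>\<gamma>\<bar>) summable_on UNIV"
proof -
  have "((\<lambda>\<gamma>. complex_of_real q ^ nat \<bar>\<gamma>\<bar> * 1 powi \<gamma>) has_sum ((1 - (complex_of_real q)\<^sup>2) * 1 / ((1 - complex_of_real q * 1) * (1 - complex_of_real q)))) UNIV"
    using assms by (intro has_sum_geometric_int) auto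
  then have "(\<lambda>\<gamma>. complex_of_real (q ^ nat \<bar>\<gamma>\<bar>)) summable_on UNIV"
    by (simp add: has_sum_imp_summable)
  from summable_on_Re[OF this] show ?thesis by simp
qed

text \<open>Geometric decay beats polynomial growth; this secures convolutions with
  \<open>G\<close>, which grows like a power of degree 2m - 1.\<close>

lemma summable_polynomial_geometric_int:
  fixes l :: complex and f :: "int \<Rightarrow> complex" and C :: real and B :: nat
  assumes l: "norm l < 1" and C: "0 \<le> C"
    and f: "\<And>\<gamma>. norm (f \<gamma>) \<le> C * (real B + real_of_int \<bar>\<gamma>\<bar>) ^ d"
  shows "(\<lambda>\<gamma>. l ^ nat \<bar>\<gamma>\<bar> * f \<gamma>) summable_on UNIV"
proof -
  \<comment> \<open>Strictly between \<open>norm l\<close> and 1: powers of \<open>1 / r\<close>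
    absorb the polynomial, and the ratio \<open>q\<close> that remains is still below 1.\<close>
  define r where "r = (1 + norm l) / 2"
  have r: "0 < r" "r < 1" "norm l < r"
    using l by (auto simp: r_def) (simp add: add_pos_nonneg)
  define q where "q = norm l / r"
  have q: "0 \<le> q" "q < 1" using r by (auto simp: q_def)
  \<comment> \<open>Chosen so that \<open>exp e\<close> equals \<open>1 / r\<close>.\<close>
  define e where "e = - ln r"
  have e: "e > 0" using r by (simp add: e_def)
  define K where "K = C * (fact d / e ^ d * exp (e * real B))"
  have poly_le: "x ^ d \<le> fact d / e ^ d * exp (e * x)" if "x \<ge> 0" for x :: real
  proof -
    have "(e * x) ^ d / fact d \<le> exp (e * x)"
    proof -
      have s: "(\<lambda>n. (e * x) ^ n /\<^sub>R fact n) sums exp (e * x)" by (rule exp_converges)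
      \<comment> \<open>A single term of the exponential series, all of whose terms are nonnegative
        here, is at most its sum.\<close>
      have "sum (\<lambda>n. (e * x) ^ n /\<^sub>R fact n) {d} \<le> (\<Sum>n. (e * x) ^ n /\<^sub>R fact n)"
        using e that by (intro sum_le_suminf) (use s in \<open>auto simp: sums_iff\<close>)
      then show ?thesis using s by (simp add: sums_iff field_simps)
    qed
    then show ?thesis using e by (simp add: field_simps power_mult_distrib)
  qed
  have bound: "norm (l ^ nat \<bar>\<gamma>\<bar> * f \<gamma>) \<le> K * q ^ nat \<bar>\<gamma>\<bar>" for \<gamma>
  proof -
    have "(real B + real_of_int \<bar>\<gamma>\<bar>) ^ d \<le> fact d / e ^ d * exp (e * (real B + real_of_int \<bar>\<gamma>\<bar>))"
      by (intro poly_le) auto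
    also have "exp (e * (real B + real_of_int \<bar>\<gamma>\<bar>)) = exp (e * real B) * exp e ^ nat \<bar>\<gamma>\<bar>"
      by (simp add: exp_of_nat_mult[symmetric] ring_distribs exp_add mult.commute)
    also have "exp e = 1 / r"
      using r by (simp add: e_def exp_minus field_simps)
    finally have "C * (real B + real_of_int \<bar>\<gamma>\<bar>) ^ d \<le> K * (1 / r) ^ nat \<bar>\<gamma>\<bar>"
      using mult_left_mono[OF _ C] by (fastforce simp: K_def mult.assoc)
    then have "norm (f \<gamma>) \<le> K * (1 / r) ^ nat \<bar>\<gamma>\<bar>"
      using f[of \<gamma>] by linarith
    then have "norm l ^ nat \<bar>\<gamma>\<bar> * norm (f \<gamma>) \<le> norm l ^ nat \<bar>\<gamma>\<bar> * (K * (1 / r) ^ nat \<bar>\<gamma>\<bar>)"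
      by (intro mult_left_mono) auto
    also have "\<dots> = K * q ^ nat \<bar>\<gamma>\<bar>"
      by (simp add: q_def power_divide)
    finally show ?thesis by (simp add: norm_mult norm_power)
  qed
  have "(\<lambda>\<gamma>::int. K * q ^ nat \<bar>\<gamma>\<bar>) summable_on UNIV"
    using q by (intro summable_on_cmult_right summable_geometric_int)
  then have "(\<lambda>\<gamma>. norm (l ^ nat \<bar>\<gamma>\<bar> * f \<gamma>)) summable_on UNIV"
    by (rule summable_on_comparison_test) (use bound in auto)
  then show ?thesis
    by (rule abs_summable_summable)
qed

subsection \<open>Uniqueness of Fourier coefficients\<close>

lemma exp_2pi_i_eq_1_iff: "exp (2 * of_real pi * \<i> * z) = 1 \<longleftrightarrow> z \<in> \<int>"
proof
  assume "exp (2 * of_real pi * \<i> * z) = 1"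
  then obtain n :: int where "Im z = 0" "2 * pi * Re z = of_int (2 * n) * pi"
    unfolding exp_eq_1 by auto
  then have "z = of_int n"
    by (simp add: complex_eq_iff)
  then show "z \<in> \<int>" by simp
next
  assume "z \<in> \<int>"
  then obtain n where "z = of_int n" by (auto elim: Ints_cases)
  then show "exp (2 * of_real pi * \<i> * z) = 1"
    unfolding exp_eq_1 by auto
qed

text \<open>Discrete orthogonality: the summands are the powers of one N-th root of unity
  \<open>y\<close>, so the geometric sum is 0 unless \<open>y = 1\<close>.\<close>

lemma sum_roots_of_unity_power_int:
  fixes \<gamma> :: int and N :: nat
  assumes N: "N > 0"
  shows "(\<Sum>j<N. exp (2 * of_real pi * \<i> * (of_nat j / of_nat N)) powi \<gamma>) =
    (if int N dvd \<gamma> then of_nat N else 0)"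
proof -
  define y where "y = exp (2 * of_real pi * \<i> * (of_int \<gamma> / of_nat N))"
  have y: "exp (2 * of_real pi * \<i> * (of_nat j / of_nat N)) powi \<gamma> = y ^ j" for j
    by (simp add: y_def exp_power_int exp_of_nat_mult[symmetric] mult_ac)
  have "y = 1 \<longleftrightarrow> int N dvd \<gamma>"
  proof -
    have "complex_of_int \<gamma> / of_nat N \<in> \<int> \<longleftrightarrow> int N dvd \<gamma>"
      using N of_int_div_of_int_in_Ints_iff[of \<gamma> "int N", where 'a = complex] by simp
    then show ?thesis unfolding y_def exp_2pi_i_eq_1_iff .
  qed
  moreover have "y ^ N = 1"
    using N exp_2pi_i_eq_1_iff[of "of_int \<gamma>"] by (simp add: y_def exp_of_nat_mult[symmetric] mult_ac)
  ultimately show ?thesis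
    unfolding y using geometric_sum[of y N] by auto
qed

text \<open>Averaging over the N-th roots of unity takes the place of integration over the circle.
  Only coefficients with index divisible by \<open>N\<close> survive, and for large \<open>N\<close>
  all of them but \<open>a 0\<close> lie in an arbitrarily small tail.\<close>

lemma Fourier_coeff_0_eq_0:
  fixes a :: "int \<Rightarrow> complex"
  assumes a: "\<And>z. norm z = 1 \<Longrightarrow> ((\<lambda>\<gamma>. a \<gamma> * z powi \<gamma>) has_sum 0) UNIV"
  shows "a 0 = 0"
proof -
  have "a summable_on UNIV"
    using has_sum_imp_summable[OF a[of 1]] by simp
  \<comment> \<open>Unconditional summability of complex families is absolute, so tails can be
    estimated in norm.\<close>
  then have abs: "(\<lambda>\<gamma>. norm (a \<gamma>)) summable_on B" for B
    using summable_on_iff_abs_summable_on_complex summable_on_subset_banach by blast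
  have "norm (a 0) \<le> \<epsilon>" if \<epsilon>: "\<epsilon> > 0" for \<epsilon>
  proof -
    obtain F where F: "finite F" "dist (\<Sum>\<gamma>\<in>F. norm (a \<gamma>)) (\<Sum>\<^sub>\<infinity>\<gamma>. norm (a \<gamma>)) \<le> \<epsilon>"
      using infsum_finite_approximation[OF abs \<epsilon>] by auto
    \<comment> \<open>Larger than every absolute value in \<open>F\<close>, so that no nonzero
      multiple of \<open>N\<close> lies in \<open>F\<close>.\<close>
    define N where "N = Suc (\<Sum>\<gamma>\<in>F. nat \<bar>\<gamma>\<bar>)"
    have N: "N > 0"
      by (simp add: N_def)
    define B where "B = {\<gamma>. int N dvd \<gamma>} - {0}"
    have FB: "F \<inter> B = {}"
    proof (intro equals0I)
      fix \<gamma> assume \<gamma>: "\<gamma> \<in> F \<inter> B"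
      then have "nat \<bar>\<gamma>\<bar> < N"
        using F(1) by (auto simp: N_def less_Suc_eq_le intro!: member_le_sum)
      moreover have "int N \<le> \<bar>\<gamma>\<bar>"
        using \<gamma> by (auto simp: B_def intro: zdvd_imp_le)
      ultimately show False by linarith
    qed
    have "((\<lambda>\<gamma>. \<Sum>j<N. a \<gamma> * exp (2 * of_real pi * \<i> * (of_nat j / of_nat N)) powi \<gamma>) has_sum (\<Sum>j<N. 0)) UNIV"
      by (intro has_sum_sum a) (auto simp: norm_exp_eq_Re)
    then have "((\<lambda>\<gamma>. a \<gamma> * (if int N dvd \<gamma> then of_nat N else 0)) has_sum 0) UNIV"
      unfolding sum_distrib_left[symmetric]
      by (subst (asm) sum_roots_of_unity_power_int[OF N]) simp
    then have "((\<lambda>\<gamma>. a \<gamma> * (if int N dvd \<gamma> then of_nat N else 0) * inverse (of_nat N)) has_sum (0 * inverse (of_nat N))) UNIV"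
      by (rule has_sum_cmult_left)
    then have "(a has_sum 0) {\<gamma>. int N dvd \<gamma>}"
      using N by (subst has_sum_cong_neutral[where T = UNIV]) auto
    also have "{\<gamma>. int N dvd \<gamma>} = insert 0 B"
      by (auto simp: B_def)
    finally have "(a has_sum 0) (insert 0 B)" .
    moreover have "a summable_on B"
      using abs[of B] by (rule abs_summable_summable)
    then have "(a has_sum (a 0 + infsum a B)) (insert 0 B)"
      by (intro has_sum_insert) (auto simp: B_def)
    ultimately have "a 0 + infsum a B = 0"
      using has_sum_unique by blast
    then have "norm (a 0) = norm (infsum a B)"
      by (metis add_eq_0_iff norm_minus_cancel)
    also have "\<dots> \<le> (\<Sum>\<^sub>\<infinity>\<gamma>\<in>B. norm (a \<gamma>))"
      using abs by (rule norm_infsum_bound)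
    also have "\<dots> \<le> (\<Sum>\<^sub>\<infinity>\<gamma>\<in>UNIV - F. norm (a \<gamma>))"
      by (rule infsum_mono2[OF abs abs]) (use FB in auto)
    also have "\<dots> = (\<Sum>\<^sub>\<infinity>\<gamma>. norm (a \<gamma>)) - (\<Sum>\<gamma>\<in>F. norm (a \<gamma>))"
      using infsum_Diff[OF abs abs, of F UNIV] F(1) by simp
    also have "\<dots> \<le> \<epsilon>"
      using F(2) by (simp add: dist_real_def)
    finally show ?thesis .
  qed
  then show ?thesis
    using field_le_epsilon[of "norm (a 0)" 0] by simp
qed

text \<open>Shifting \<open>a - b\<close> by \<beta> brings any coefficient to index 0; the factor
  this adds to the series is a power of z and is divided out.\<close>

lemma Fourier_coeffs_unique:
  fixes a b :: "int \<Rightarrow> complex"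
  assumes a: "\<And>z. norm z = 1 \<Longrightarrow> ((\<lambda>\<gamma>. a \<gamma> * z powi \<gamma>) has_sum f z) UNIV"
    and b: "\<And>z. norm z = 1 \<Longrightarrow> ((\<lambda>\<gamma>. b \<gamma> * z powi \<gamma>) has_sum f z) UNIV"
  shows "a = b"
proof
  fix \<beta>
  have "a (0 + \<beta>) - b (0 + \<beta>) = 0"
  proof (rule Fourier_coeff_0_eq_0)
    fix z :: complex assume z: "norm z = 1"
    have "((\<lambda>\<gamma>. a \<gamma> * z powi \<gamma> - b \<gamma> * z powi \<gamma>) has_sum (f z - f z)) UNIV"
      using has_sum_add[OF a[OF z] has_sum_uminusI[OF b[OF z]]] by simp
    then have "((\<lambda>\<gamma>. (a \<gamma> - b \<gamma>) * z powi \<gamma>) has_sum 0) UNIV"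
      by (simp add: left_diff_distrib)
    then have "((\<lambda>\<gamma>. (a (\<gamma> + \<beta>) - b (\<gamma> + \<beta>)) * z powi (\<gamma> + \<beta>)) has_sum 0) UNIV"
      by (subst has_sum_int_shift)
    then have "((\<lambda>\<gamma>. (a (\<gamma> + \<beta>) - b (\<gamma> + \<beta>)) * z powi (\<gamma> + \<beta>) * z powi (- \<beta>)) has_sum (0 * z powi (- \<beta>))) UNIV"
      by (rule has_sum_cmult_left)
    moreover have "z \<noteq> 0" using z by auto
    then have "z powi (\<gamma> + \<beta>) * z powi (- \<beta>) = z powi \<gamma>" for \<gamma>
      by (simp flip: power_int_add)
    ultimately show "((\<lambda>\<gamma>. (a (\<gamma> + \<beta>) - b (\<gamma> + \<beta>)) * z powi \<gamma>) has_sum 0) UNIV"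
      by (simp add: mult.assoc)
  qed
  then show "a \<beta> = b \<beta>" by simp
qed

text \<open>By this rule, convolution with a finitely supported sequence becomes multiplication of
  the Fourier series by a Laurent polynomial.\<close>

lemma has_sum_shift_powi:
  fixes a :: "int \<Rightarrow> complex"
  assumes "((\<lambda>\<gamma>. a \<gamma> * z powi \<gamma>) has_sum s) UNIV" and "z \<noteq> 0"
  shows "((\<lambda>\<gamma>. a (\<gamma> - k) * z powi \<gamma>) has_sum (z powi k * s)) UNIV"
proof -
  have "((\<lambda>\<gamma>. a (\<gamma> + - k) * z powi (\<gamma> + - k)) has_sum s) UNIV"
    by (subst has_sum_int_shift) (rule assms(1))
  from has_sum_cmult_right[OF this, of "z powi k"] show ?thesis
    using assms(2) by (simp add: mult_ac power_int_diff)
qed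

subsection \<open>Partial fractions of the reciprocal Euler polynomial\<close>

lemma poly_pderiv_linear_mult: "poly (pderiv ([:- r, 1:] * q)) r = poly q (r::'a::idom)"
  unfolding pderiv_mult poly_add poly_mult by (simp add: pderiv_pCons)

text \<open>Lagrange interpolation: since \<open>n < card R\<close>, the monomial equals its
  interpolant at the nodes \<open>R\<close>, and division by \<open>p\<close> leaves simple
  fractions.\<close>

lemma partial_fraction_monomial:
  fixes R :: "'a::field set"
  assumes fin: "finite R" and p: "p = smult c (\<Prod>r\<in>R. [:- r, 1:])" and c: "c \<noteq> 0"
    and n: "n < card R" and z: "z \<notin> R"
  shows "z ^ n / poly p z = (\<Sum>r\<in>R. r ^ n / (poly (pderiv p) r * (z - r)))"
proof -
  \<comment> \<open>Up to the factor \<open>c\<close>, \<open>q r\<close> is \<open>p\<close>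
    without its linear factor at \<open>r\<close>, so \<open>c\<close> times its value there is the
    derivative of \<open>p\<close>.\<close>
  define q where "q = (\<lambda>r. \<Prod>s\<in>R - {r}. [:- s, 1:])"
  have p_q: "p = [:- r, 1:] * smult c (q r)" if "r \<in> R" for r
    using that fin by (simp add: p q_def prod.remove)
  have dp: "poly (pderiv p) r = c * poly (q r) r" if "r \<in> R" for r
    using poly_pderiv_linear_mult[of r "smult c (q r)"] p_q[OF that] by simp
  have q_nz: "poly (q r) r \<noteq> 0" if "r \<in> R" for r
    using fin by (auto simp: q_def poly_prod)
  have q_0: "poly (q r) s = 0" if "r \<in> R" "s \<in> R" "r \<noteq> s" for r s
    using fin that by (auto simp: q_def poly_prod)
  have "monom 1 n = (\<Sum>r\<in>R. smult (r ^ n / poly (q r) r) (q r))"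
  proof (rule poly_eqI_degree[of R])
    fix x assume x: "x \<in> R"
    have "poly (\<Sum>r\<in>R. smult (r ^ n / poly (q r) r) (q r)) x
        = (\<Sum>r\<in>R. if r = x then r ^ n else 0)"
      unfolding poly_sum by (intro sum.cong) (use x q_nz q_0 in auto)
    then show "poly (monom 1 n) x = poly (\<Sum>r\<in>R. smult (r ^ n / poly (q r) r) (q r)) x"
      using fin x by (simp add: poly_monom)
  next
    show "degree (monom (1::'a) n) < card R"
      using n by (simp add: degree_monom_eq)
    have "degree (q r) \<le> card R - 1" if "r \<in> R" for r
    proof -
      have "degree (q r) \<le> (\<Sum>s\<in>R - {r}. degree [:- s, 1:])"
        unfolding q_def using degree_prod_sum_le[of "R - {r}" "\<lambda>s. [:- s, 1:]"] fin by (simp add: comp_def)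
      then show ?thesis using fin that by simp
    qed
    then have "degree (\<Sum>r\<in>R. smult (r ^ n / poly (q r) r) (q r)) \<le> card R - 1"
      using fin by (intro degree_sum_le) (auto intro: order.trans[OF degree_smult_le])
    then show "degree (\<Sum>r\<in>R. smult (r ^ n / poly (q r) r) (q r)) < card R"
      using n by linarith
  qed
  then have "z ^ n = (\<Sum>r\<in>R. r ^ n / poly (q r) r * poly (q r) z)"
    using poly_monom[of 1 n z] by (simp add: poly_sum)
  then have "z ^ n / poly p z = (\<Sum>r\<in>R. r ^ n / poly (q r) r * poly (q r) z / poly p z)"
    by (simp add: sum_divide_distrib)
  also have "\<dots> = (\<Sum>r\<in>R. r ^ n / (poly (pderiv p) r * (z - r)))"
  proof (rule sum.cong)
    fix r assume r: "r \<in> R"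
    have "poly (q r) z \<noteq> 0"
      using fin z by (auto simp: q_def poly_prod)
    moreover have "z \<noteq> r" using r z by auto
    moreover have "poly p z = (z - r) * (c * poly (q r) z)"
      by (subst p_q[OF r]) (simp add: algebra_simps)
    ultimately show "r ^ n / poly (q r) r * poly (q r) z / poly p z = r ^ n / (poly (pderiv p) r * (z - r))"
      unfolding dp[OF r] by (simp add: mult_ac)
  qed simp
  finally show ?thesis .
qed

lemma poly_eq_prod_roots:
  fixes p :: "'a::idom poly"
  assumes R: "finite R" "\<And>r. r \<in> R \<Longrightarrow> poly p r = 0" and deg: "degree p = card R" and p: "p \<noteq> 0"
  shows "p = smult (lead_coeff p) (\<Prod>r\<in>R. [:- r, 1:])"
proof -
  have deg': "degree (\<Prod>r\<in>R. [:- r, 1:]) = card R"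
    by (subst degree_prod_eq_sum_degree) auto
  have lc: "lead_coeff (\<Prod>r\<in>R. [:- r, 1:]) = 1"
    by (simp add: lead_coeff_prod)
  show ?thesis
  proof (cases "card R = 0")
    case True
    then show ?thesis
      using R deg degree_0_id[of p] by (auto simp: smult_one)
  next
    case False
    show ?thesis
    proof (rule poly_eqI_degree_lead_coeff[where n = "card R" and A = R])
      show "degree (smult (lead_coeff p) (\<Prod>r\<in>R. [:- r, 1:])) \<le> card R"
        using deg' by (intro order.trans[OF degree_smult_le]) simp
      fix z assume "z \<in> R"
      then show "poly p z = poly (smult (lead_coeff p) (\<Prod>r\<in>R. [:- r, 1:])) z"
        using R by (auto simp: poly_prod)
    qed (use R deg deg' lc in auto)
  qed
qed

section \<open>The roots of the Euler polynomial in inverse pairs\<close>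

locale euler_roots =
  fixes m :: nat and lam :: "nat \<Rightarrow> complex"
  assumes m: "m \<ge> 2"
    and lam: "bij_betw lam {1..m - 1} {z. poly (eulerian (2 * m - 2)) z = 0 \<and> norm z < 1}"
begin

abbreviation E :: "complex poly" where "E \<equiv> eulerian (2 * m - 2)"

text \<open>The convolution inverse of the coefficient sequence of \<open>E\<close> centred at index
  m - 1 (see \<open>convolve_S_E\<close>).\<close>

definition S :: "int \<Rightarrow> complex" where
  "S \<gamma> = (\<Sum>k = 1..m - 1. lam k powi (\<bar>\<gamma>\<bar> + int m - 2) / poly (pderiv E) (lam k))"

lemma lam_root:
  assumes "k \<in> {1..m - 1}"
  shows "poly E (lam k) = 0" "norm (lam k) < 1" "lam k \<noteq> 0"
proof -
  show *: "poly E (lam k) = 0" "norm (lam k) < 1"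
    using bij_betwE[OF lam] assms by blast+
  show "lam k \<noteq> 0"
    using * by (auto simp: poly_0_coeff_0)
qed

lemma inverse_lam_root:
  assumes "k \<in> {1..m - 1}"
  shows "poly E (inverse (lam k)) = 0" "norm (inverse (lam k)) > 1"
  using lam_root[OF assms] poly_eulerian_inverse[of "lam k" "2 * m - 2"]
  by (auto simp: norm_inverse one_less_inverse)

definition roots :: "complex set" where
  "roots = lam ` {1..m - 1} \<union> (\<lambda>k. inverse (lam k)) ` {1..m - 1}"

lemma inj_lam: "inj_on lam {1..m - 1}"
  using lam by (rule bij_betw_imp_inj_on)

lemma inj_inverse_lam: "inj_on (\<lambda>k. inverse (lam k)) {1..m - 1}"
  using inj_lam by (auto simp: inj_on_def)

lemma roots_disjoint: "lam ` {1..m - 1} \<inter> (\<lambda>k. inverse (lam k)) ` {1..m - 1} = {}"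
  using lam_root(2) inverse_lam_root(2) by fastforce

lemma finite_roots: "finite roots"
  by (simp add: roots_def)

lemma card_roots: "card roots = 2 * m - 2"
  unfolding roots_def
  using m by (subst card_Un_disjoint[OF _ _ roots_disjoint])
    (simp_all add: card_image inj_lam inj_inverse_lam del: One_nat_def)

text \<open>By counting: the m - 1 roots inside the unit circle and their inverses outside are
  distinct and as many as the degree. Hence all roots are simple and none lies on the
  circle.\<close>

lemma E_eq_prod: "E = smult 1 (\<Prod>r\<in>roots. [:- r, 1:])"
proof -
  have lc: "lead_coeff E = 1"
    by (simp add: coeff_eulerian_lead)
  have "E = smult (lead_coeff E) (\<Prod>r\<in>roots. [:- r, 1:])"
  proof (rule poly_eq_prod_roots)
    show "poly E r = 0" if "r \<in> roots" for r
      using that lam_root(1) inverse_lam_root(1) by (auto simp: roots_def)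
    show "E \<noteq> 0"
      by (metis coeff_0 coeff_eulerian_lead one_neq_zero)
  qed (auto simp: finite_roots card_roots)
  then show ?thesis unfolding lc .
qed

lemma norm_roots: "r \<in> roots \<Longrightarrow> norm r \<noteq> 1"
  using lam_root(2) inverse_lam_root(2) by (fastforce simp: roots_def)

lemma E_nonzero_circle: "norm z = 1 \<Longrightarrow> poly E z \<noteq> 0"
  using norm_roots finite_roots by (subst E_eq_prod) (auto simp: poly_prod)

lemma pderiv_E_lam_nonzero:
  assumes "k \<in> {1..m - 1}"
  shows "poly (pderiv E) (lam k) \<noteq> 0"
proof -
  have r: "lam k \<in> roots" using assms by (auto simp: roots_def)
  have "E = [:- lam k, 1:] * (\<Prod>s\<in>roots - {lam k}. [:- s, 1:])" (is "_ = _ * ?q")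
    using E_eq_prod prod.remove[OF finite_roots r, of "\<lambda>s. [:- s, 1:]"] by (simp only: smult_1_left)
  then have "poly (pderiv E) (lam k) = poly ?q (lam k)"
    using poly_pderiv_linear_mult[of "lam k" ?q] by simp
  also have "\<dots> \<noteq> 0"
    using finite_roots by (auto simp: poly_prod)
  finally show ?thesis .
qed

text \<open>Differentiate E(z) = z^(2m-2) E(1/z) at a root l. The term containing E(1/l) vanishes,
  and the inner derivative -1/l^2 lowers the exponent to 2m - 4.\<close>

lemma pderiv_E_inverse:
  assumes "k \<in> {1..m - 1}"
  shows "poly (pderiv E) (inverse (lam k)) = - poly (pderiv E) (lam k) / lam k ^ (2 * m - 4)"
proof -
  define l where "l = lam k"
  have l: "l \<noteq> 0" "poly E l = 0" "poly E (inverse l) = 0"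
    using lam_root[OF assms] inverse_lam_root[OF assms] by (auto simp: l_def)
  define j where "j = 2 * m - 4"
  have j: "2 * m - 2 = Suc (Suc j)" "2 * m - 4 = j"
    using m by (auto simp: j_def)
  have "((\<lambda>z. z ^ (2 * m - 2) * poly E (inverse z)) has_field_derivative
          l ^ (2 * m - 2) * (poly (pderiv E) (inverse l) * - (1 / l\<^sup>2))) (at l)"
  proof -
    have d: "((\<lambda>z. poly E (inverse z)) has_field_derivative
        poly (pderiv E) (inverse l) * - (inverse l ^ Suc (Suc 0))) (at l)"
      using DERIV_chain2[OF poly_DERIV DERIV_inverse[OF l(1)]] .
    have *: "a * - (inverse l ^ Suc (Suc 0)) * b = b * (a * - (1 / l\<^sup>2))" for a b
      by (simp add: power2_eq_square divide_inverse)
    note DERIV_mult[OF DERIV_power[OF DERIV_ident, where n = "2 * m - 2"] d]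
    then show ?thesis
      by (rule DERIV_cong) (simp only: l(3) mult_zero_right add_0_left *)
  qed
  then have "(poly E has_field_derivative
          l ^ (2 * m - 2) * (poly (pderiv E) (inverse l) * - (1 / l\<^sup>2))) (at l)"
    by (rule has_field_derivative_transform_within_open[of _ _ _ "- {0}"])
      (use l in \<open>auto simp: poly_eulerian_inverse[symmetric]\<close>)
  from DERIV_unique[OF this poly_DERIV]
  have "poly (pderiv E) l = - (l ^ j * poly (pderiv E) (inverse l))"
    using l(1) by (simp only: j) (simp add: power2_eq_square)
  then show ?thesis
    unfolding l_def[symmetric] j(2) using l(1) by simp
qed

lemma S_eq: "S \<gamma> = (\<Sum>k = 1..m - 1. lam k ^ (m - 2) / poly (pderiv E) (lam k) * lam k ^ nat \<bar>\<gamma>\<bar>)"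
  unfolding S_def
proof (rule sum.cong)
  fix k
  have "\<bar>\<gamma>\<bar> + int m - 2 = int ((m - 2) + nat \<bar>\<gamma>\<bar>)" using m by simp
  then have "lam k powi (\<bar>\<gamma>\<bar> + int m - 2) = lam k ^ ((m - 2) + nat \<bar>\<gamma>\<bar>)"
    by (simp only: power_int_of_nat)
  then show "lam k powi (\<bar>\<gamma>\<bar> + int m - 2) / poly (pderiv E) (lam k)
      = lam k ^ (m - 2) / poly (pderiv E) (lam k) * lam k ^ nat \<bar>\<gamma>\<bar>"
    by (simp add: power_add)
qed simp

text \<open>The exponent m - 2 is the balanced one: the residues at l and 1/l are then l^(m-2) /
  E'(l) and its negative, so each pair merges into the closed form of a two-sided geometric
  series.\<close>

lemma partial_fraction_E:
  assumes z: "norm z = 1"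
  shows "z ^ (m - 2) / poly E z = (\<Sum>k = 1..m - 1. lam k ^ (m - 2) / poly (pderiv E) (lam k) *
           ((1 - (lam k)\<^sup>2) / ((1 - lam k * z) * (z - lam k))))"
proof -
  define g where "g = (\<lambda>r. r ^ (m - 2) / (poly (pderiv E) r * (z - r)))"
  have "z ^ (m - 2) / poly E z = (\<Sum>r\<in>roots. g r)"
    unfolding g_def
    by (rule partial_fraction_monomial[OF finite_roots E_eq_prod])
      (use m z norm_roots in \<open>auto simp: card_roots\<close>)
  also have "\<dots> = (\<Sum>k = 1..m - 1. g (lam k)) + (\<Sum>k = 1..m - 1. g (inverse (lam k)))"
    unfolding roots_def
    by (subst sum.union_disjoint[OF _ _ roots_disjoint])
      (simp_all add: sum.reindex inj_lam inj_inverse_lam del: One_nat_def)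
  also have "\<dots> = (\<Sum>k = 1..m - 1. g (lam k) + g (inverse (lam k)))"
    by (simp add: sum.distrib)
  also have "\<dots> = (\<Sum>k = 1..m - 1. lam k ^ (m - 2) / poly (pderiv E) (lam k) *
           ((1 - (lam k)\<^sup>2) / ((1 - lam k * z) * (z - lam k))))"
  proof (rule sum.cong)
    fix k assume k: "k \<in> {1..m - 1}"
    define l d where "l = lam k" and "d = poly (pderiv E) l"
    have l: "l \<noteq> 0" and d: "d \<noteq> 0" and zl: "z - l \<noteq> 0"
      using lam_root[OF k] pderiv_E_lam_nonzero[OF k] z by (auto simp: l_def d_def)
    have lz: "1 - l * z \<noteq> 0"
    proof
      assume "1 - l * z = 0"
      then have "norm (l * z) = 1" by simp
      then show False using lam_root(2)[OF k] z by (simp add: norm_mult l_def)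
    qed
    have d': "poly (pderiv E) (inverse l) = - d / l ^ (2 * m - 4)"
      using pderiv_E_inverse[OF k] by (simp add: l_def d_def)
    \<comment> \<open>One half cancels against the power of \<open>inverse l\<close> in the
      numerator of \<open>g\<close>.\<close>
    have *: "2 * m - 4 = (m - 2) + (m - 2)" by simp
    have "g (inverse l) = - (l ^ (m - 2) / (d * (z - inverse l)))"
      unfolding g_def d' * power_add using l d by (simp add: field_simps)
    also have "z - inverse l = - (1 - l * z) / l"
      using l by (simp add: field_simps)
    finally have "g (inverse l) = l ^ (m - 2) / d * (l / (1 - l * z))"
      using l lz d by (simp add: field_simps)
    moreover have "g l = l ^ (m - 2) / d * (1 / (z - l))"
      by (simp add: g_def d_def)
    ultimately have "g l + g (inverse l) = l ^ (m - 2) / d * (1 / (z - l) + l / (1 - l * z))"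
      by (simp add: ring_distribs)
    also have "1 / (z - l) + l / (1 - l * z) = (1 - l\<^sup>2) / ((1 - l * z) * (z - l))"
      using lz zl by (simp add: add_frac_eq) (simp add: algebra_simps power2_eq_square)
    finally show "g (lam k) + g (inverse (lam k)) = lam k ^ (m - 2) / poly (pderiv E) (lam k) *
           ((1 - (lam k)\<^sup>2) / ((1 - lam k * z) * (z - lam k)))"
      by (simp add: l_def d_def)
  qed simp
  finally show ?thesis .
qed

text \<open>Each pair of poles is expanded by \<open>has_sum_geometric_int\<close>, whose numerator
  supplies the extra factor z that raises m - 2 to m - 1.\<close>

lemma has_sum_S_circle:
  assumes z: "norm z = 1"
  shows "((\<lambda>\<gamma>. S \<gamma> * z powi \<gamma>) has_sum (z ^ (m - 1) / poly E z)) UNIV"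
proof -
  have "((\<lambda>\<gamma>. \<Sum>k = 1..m - 1. lam k ^ (m - 2) / poly (pderiv E) (lam k) * (lam k ^ nat \<bar>\<gamma>\<bar> * z powi \<gamma>)) has_sum
      (\<Sum>k = 1..m - 1. lam k ^ (m - 2) / poly (pderiv E) (lam k) *
         ((1 - (lam k)\<^sup>2) * z / ((1 - lam k * z) * (z - lam k))))) UNIV"
    by (intro has_sum_sum has_sum_cmult_right has_sum_geometric_int lam_root z) auto
  also have "(\<Sum>k = 1..m - 1. lam k ^ (m - 2) / poly (pderiv E) (lam k) *
         ((1 - (lam k)\<^sup>2) * z / ((1 - lam k * z) * (z - lam k)))) = z * (z ^ (m - 2) / poly E z)"
    unfolding partial_fraction_E[OF z] sum_distrib_left by (intro sum.cong) auto
  also have "z * (z ^ (m - 2) / poly E z) = z ^ (m - 1) / poly E z"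
    using m by (simp add: power_Suc[symmetric] Suc_diff_le[symmetric] numeral_2_eq_2 del: power_Suc)
  finally show ?thesis
    by (simp add: S_eq sum_distrib_right mult.assoc)
qed

end

subsection \<open>The lattice sum of inverse powers\<close>

lemma not_Ints_reflect: "(z::complex) \<notin> \<int> \<Longrightarrow> z \<notin> \<int>\<^sub>\<le>\<^sub>0 \<and> 1 - z \<notin> \<int> \<and> 1 - z \<notin> \<int>\<^sub>\<le>\<^sub>0"
  by (metis Ints_1 Ints_diff add_diff_cancel_left' diff_add_cancel nonpos_Ints_Int)

text \<open>Logarithmic differentiation of the reflection formula
  \<open>rGamma z * rGamma (1 - z)\<close> = sin(pi z) / pi, which is nonzero off the
  integers.\<close>

lemma Digamma_reflection:
  fixes z :: complex
  assumes z: "z \<notin> \<int>"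
  shows "Digamma (1 - z) - Digamma z = of_real pi * cos (of_real pi * z) / sin (of_real pi * z)"
proof -
  note z' = not_Ints_reflect[OF z]
  have 0: "sin (of_real pi * z) \<noteq> 0"
    using rGamma_reflection_complex[of z] z' by (auto simp: rGamma_eq_zero_iff)
  have 1: "((\<lambda>z. rGamma z * rGamma (1 - z)) has_field_derivative
      rGamma z * rGamma (1 - z) * (Digamma (1 - z) - Digamma z)) (at z)"
    using z' by (auto intro!: derivative_eq_intros simp: algebra_simps)
  have 2: "((\<lambda>z. rGamma z * rGamma (1 - z)) has_field_derivative cos (of_real pi * z)) (at z)"
    unfolding rGamma_reflection_complex by (auto intro!: derivative_eq_intros)
  from DERIV_unique[OF 1 2]
  have "sin (of_real pi * z) / of_real pi * (Digamma (1 - z) - Digamma z) = cos (of_real pi * z)"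
    by (simp only: rGamma_reflection_complex)
  then show ?thesis
    using 0 by (simp add: nonzero_eq_divide_eq nonzero_divide_eq_eq mult.commute)
qed

lemma pi_cot_eq_exp:
  fixes z :: complex
  assumes z: "z \<notin> \<int>"
  defines "w \<equiv> exp (2 * of_real pi * \<i> * z)"
  shows "of_real pi * cos (of_real pi * z) / sin (of_real pi * z) = of_real pi * \<i> * (w + 1) / (w - 1)"
proof -
  define u where "u = exp (\<i> * (of_real pi * z))"
  have u: "u \<noteq> 0" by (simp add: u_def)
  have w: "w = u\<^sup>2"
    by (simp add: w_def u_def exp_double[symmetric] mult_ac)
  have "w \<noteq> 1"
    using z exp_2pi_i_eq_1_iff by (simp add: w_def)
  then have "u\<^sup>2 - 1 \<noteq> 0" "u - inverse u \<noteq> 0"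
    using u by (auto simp: w power2_eq_square field_simps)
  moreover have "cos (of_real pi * z) = (u + inverse u) / 2" "sin (of_real pi * z) = (u - inverse u) / (2 * \<i>)"
    by (simp_all add: cos_exp_eq sin_exp_eq u_def exp_minus)
  moreover have "u + inverse u = (u\<^sup>2 + 1) / u" "u - inverse u = (u\<^sup>2 - 1) / u"
    using u by (simp_all add: power2_eq_square field_simps)
  ultimately have "of_real pi * cos (of_real pi * z) / sin (of_real pi * z)
      = of_real pi * ((u\<^sup>2 + 1) / u / 2) / ((u\<^sup>2 - 1) / u / (2 * \<i>))"
    by (simp only:)
  also have "\<dots> = of_real pi * \<i> * (w + 1) / (w - 1)"
  proof -
    have "c * (a / u / 2) / (b / u / (2 * \<i>)) = c * \<i> * a / b" if "b \<noteq> 0" for a b c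
      using u that by (simp add: field_simps)
    then show ?thesis
      using \<open>u\<^sup>2 - 1 \<noteq> 0\<close> unfolding w by blast
  qed
  finally show ?thesis .
qed

text \<open>The case n = 0 differentiates the cotangent formula. On functions of w = exp(2 pi i z),
  d/dz acts as 2 pi i times w d/dw, so each further derivative produces the next Eulerian numerator;
  the alternating sign comes from the argument 1 - z.\<close>

lemma Polygamma_reflection:
  fixes z :: complex
  assumes "z \<notin> \<int>"
  shows "Polygamma (Suc n) z + (- 1) ^ n * Polygamma (Suc n) (1 - z) =
    (2 * of_real pi * \<i>) ^ (n + 2) *
      (let w = exp (2 * of_real pi * \<i> * z) in w * poly (eulerian n) w / (1 - w) ^ (n + 2))"
  using assms
proof (induction n arbitrary: z)
  case 0
  define W where "W = (\<lambda>z. exp (2 * of_real pi * \<i> * z) :: complex)"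
  have W: "W z \<noteq> 1"
    using 0 exp_2pi_i_eq_1_iff by (simp add: W_def)
  note z = not_Ints_reflect[OF 0]
  have dW: "(W has_field_derivative 2 * of_real pi * \<i> * W z) (at z)"
    unfolding W_def by (auto intro!: derivative_eq_intros)
  have "((\<lambda>z. of_real pi * \<i> * (W z + 1) / (W z - 1)) has_field_derivative
      - ((2 * of_real pi * \<i>)\<^sup>2 * (W z / (1 - W z)\<^sup>2))) (at z)"
    using W by (auto intro!: derivative_eq_intros dW simp: field_simps power2_eq_square)
  \<comment> \<open>The cotangent formula is available only at non-integers, which form an open
    set.\<close>
  then have "((\<lambda>z. Digamma (1 - z) - Digamma z) has_field_derivative
      - ((2 * of_real pi * \<i>)\<^sup>2 * (W z / (1 - W z)\<^sup>2))) (at z)"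
    by (rule has_field_derivative_transform_within_open[where S = "- \<int>"])
      (use 0 in \<open>auto simp: W_def Digamma_reflection pi_cot_eq_exp open_Compl\<close>)
  moreover have "((\<lambda>z. Digamma (1 - z) - Digamma z) has_field_derivative
      - (Polygamma 1 z + Polygamma 1 (1 - z))) (at z)"
    using z by (auto intro!: derivative_eq_intros)
  ultimately have "- (Polygamma 1 z + Polygamma 1 (1 - z)) = - ((2 * of_real pi * \<i>)\<^sup>2 * (W z / (1 - W z)\<^sup>2))"
    using DERIV_unique by blast
  then show ?case
    by (simp only: neg_equal_iff_equal W_def Let_def eulerian.simps power_0 mult_1 poly_1
        mult_1_right add_0 One_nat_def)
next
  case (Suc n)
  define W where "W = (\<lambda>z. exp (2 * of_real pi * \<i> * z) :: complex)"
  have W: "W z \<noteq> 1"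
    using Suc.prems exp_2pi_i_eq_1_iff by (simp add: W_def)
  note z = not_Ints_reflect[OF Suc.prems]
  have dW: "(W has_field_derivative 2 * of_real pi * \<i> * W z) (at z)"
    unfolding W_def by (auto intro!: derivative_eq_intros)
  have "((\<lambda>z. W z * poly (eulerian n) (W z) / (1 - W z) ^ (n + 2)) has_field_derivative
      poly (eulerian (Suc n)) (W z) / (1 - W z) ^ (Suc n + 2) * (2 * of_real pi * \<i> * W z)) (at z)"
    using DERIV_chain2[OF theta_op_eulerian_step[OF W] dW] .
  from DERIV_cmult[OF this, of "(2 * of_real pi * \<i>) ^ (n + 2)"]
  have "((\<lambda>z. Polygamma (Suc n) z + (- 1) ^ n * Polygamma (Suc n) (1 - z)) has_field_derivative
    (2 * of_real pi * \<i>) ^ (n + 2) *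
      (poly (eulerian (Suc n)) (W z) / (1 - W z) ^ (Suc n + 2) * (2 * of_real pi * \<i> * W z))) (at z)"
  proof (rule has_field_derivative_transform_within_open[where S = "- \<int>"])
    show "(2 * of_real pi * \<i>) ^ (n + 2) * (W y * poly (eulerian n) (W y) / (1 - W y) ^ (n + 2)) =
        Polygamma (Suc n) y + (- 1) ^ n * Polygamma (Suc n) (1 - y)" if "y \<in> - \<int>" for y
      using Suc.IH[of y] that by (simp only: Compl_iff not_False_eq_True W_def Let_def)
  qed (use Suc.prems in \<open>auto simp: open_Compl\<close>)
  moreover have "((\<lambda>z. Polygamma (Suc n) z + (- 1) ^ n * Polygamma (Suc n) (1 - z)) has_field_derivative
      (Polygamma (Suc (Suc n)) z + (- 1) ^ Suc n * Polygamma (Suc (Suc n)) (1 - z))) (at z)"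
    using z by (auto intro!: derivative_eq_intros)
  ultimately have "Polygamma (Suc (Suc n)) z + (- 1) ^ Suc n * Polygamma (Suc (Suc n)) (1 - z) =
    (2 * of_real pi * \<i>) ^ (n + 2) *
      (poly (eulerian (Suc n)) (W z) / (1 - W z) ^ (Suc n + 2) * (2 * of_real pi * \<i> * W z))"
    by (rule DERIV_unique[rotated])
  moreover have "c ^ (n + 2) * (P / Q * (c * w)) = c ^ (Suc n + 2) * (w * P / Q)" for c P Q w :: complex
    by simp
  ultimately show ?case
    unfolding W_def Let_def by (simp only:)
qed

text \<open>Indices \<beta> \<le> 0 give the polygamma series at x and indices \<beta> \<ge> 1 the
  one at 1 - x. Evenness of 2m removes the absolute values and makes the sign in the reflection
  formula +1.\<close>

lemma has_sum_lattice_powers: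
  fixes x :: real
  assumes x: "x \<notin> \<int>" and m: "m \<ge> 1"
  defines "w \<equiv> exp (2 * of_real pi * \<i> * of_real x)"
  shows "((\<lambda>\<beta>::int. complex_of_real (1 / \<bar>x - of_int \<beta>\<bar> ^ (2 * m))) has_sum
    ((- 1) ^ m * (2 * of_real pi) ^ (2 * m) / fact (2 * m - 1) *
      (w * poly (eulerian (2 * m - 2)) w / (1 - w) ^ (2 * m)))) UNIV"
proof -
  define c where "c = complex_of_real x"
  have c: "c \<notin> \<int>" 
    using x unfolding c_def by (metis Ints_cases Ints_of_int of_real_eq_iff of_real_of_int_eq)
  note c' = not_Ints_reflect[OF c]
  obtain n where n: "2 * m = n + 2" "2 * m - 1 = Suc n" "2 * m - 2 = n" "even n"
    using m by (intro that[of "2 * m - 2"]) auto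
  define f where "f = (\<lambda>\<beta>::int. complex_of_real (1 / \<bar>x - of_int \<beta>\<bar> ^ (2 * m)))"
  \<comment> \<open>Applied to complex and to real bases, hence the generic ring.\<close>
  have reflect: "(- y) ^ Suc (Suc n) = y ^ Suc (Suc n)" "\<bar>y'\<bar> ^ Suc (Suc n) = y' ^ Suc (Suc n)"
    for y :: "'z::ring_1" and y' :: real
    using n(4) by (simp_all add: power_minus_even power_even_abs del: power_Suc)
  have abs_eq: "\<bar>x - of_int \<beta>\<bar> ^ (2 * m) = (x - of_int \<beta>) ^ Suc (Suc n)" for \<beta>
    unfolding n(1) using reflect(2) by (simp only: add_2_eq_Suc')
  have f_eq: "f \<beta> = inverse ((c - of_int \<beta>) ^ Suc (Suc n))" for \<beta>
    unfolding f_def c_def abs_eq by (simp add: inverse_eq_divide del: power_Suc)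
  have norm_f: "norm (f \<beta>) = inverse (\<bar>x - of_int \<beta>\<bar> ^ Suc (Suc n))" for \<beta>
    unfolding f_def n(1) by (simp add: inverse_eq_divide norm_divide norm_power power_abs del: power_Suc)
  have 1: "((\<lambda>k. f (- int k)) has_sum (Polygamma (Suc n) c / fact (Suc n))) UNIV"
  proof (rule norm_summable_imp_has_sum)
    have *: "f (- int k) = inverse ((c + of_nat k) ^ Suc (Suc n))" for k
      by (simp add: f_eq del: power_Suc)
    show "(\<lambda>k. f (- int k)) sums (Polygamma (Suc n) c / fact (Suc n))"
      unfolding * using Polygamma_LIMSEQ[of c "Suc n"] c' n(4) by (auto simp del: power_Suc)
    have "summable (\<lambda>k. inverse ((x + of_nat k) ^ Suc (Suc n)))"
      using x by (intro Polygamma_converges') auto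
    then show "summable (\<lambda>k. norm (f (- int k)))"
      by (simp add: norm_f reflect(2) del: power_Suc)
  qed
  have 2: "((\<lambda>k. f (int (Suc k))) has_sum (Polygamma (Suc n) (1 - c) / fact (Suc n))) UNIV"
  proof (rule norm_summable_imp_has_sum)
    have *: "f (int (Suc k)) = inverse ((1 - c + of_nat k) ^ Suc (Suc n))" for k
    proof -
      have "c - of_int (int (Suc k)) = - (1 - c + of_nat k)" by simp
      then show ?thesis unfolding f_eq by (simp only: reflect(1))
    qed
    show "(\<lambda>k. f (int (Suc k))) sums (Polygamma (Suc n) (1 - c) / fact (Suc n))"
    proof -
      have "1 - c \<noteq> 0" using c' by auto
      from Polygamma_LIMSEQ[OF this, of "Suc n"] show ?thesis
        unfolding * using n(4) by (simp del: power_Suc)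
    qed
    have "summable (\<lambda>k. inverse ((1 - x + of_nat k) ^ Suc (Suc n)))"
      using x by (intro Polygamma_converges') auto
    moreover have "norm (f (int (Suc k))) = inverse ((1 - x + of_nat k) ^ Suc (Suc n))" for k
    proof -
      have "x - of_int (int (Suc k)) = - (1 - x + of_nat k)" by simp
      then show ?thesis unfolding norm_f reflect(2) by (simp only: reflect(1))
    qed
    ultimately show "summable (\<lambda>k. norm (f (int (Suc k))))"
      by (simp only:)
  qed
  \<comment> \<open>After the change of sign the half \<beta> \<le> 0 becomes the nonnegative one,
    to which \<open>has_sum_int_split\<close> assigns the index 0.\<close>
  have "((\<lambda>\<beta>. f (- \<beta>)) has_sum (Polygamma (Suc n) c / fact (Suc n) + Polygamma (Suc n) (1 - c) / fact (Suc n))) UNIV"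
    using 1 2 by (intro has_sum_int_split) (simp_all only: minus_minus)
  then have "(f has_sum (Polygamma (Suc n) c / fact (Suc n) + Polygamma (Suc n) (1 - c) / fact (Suc n))) UNIV"
    by (subst has_sum_reindex_bij_witness[of _ uminus uminus UNIV "\<lambda>\<beta>. f (- \<beta>)"]) auto
  also have "Polygamma (Suc n) c / fact (Suc n) + Polygamma (Suc n) (1 - c) / fact (Suc n)
     = (Polygamma (Suc n) c + (- 1) ^ n * Polygamma (Suc n) (1 - c)) / fact (Suc n)"
    using n(4) by (simp add: add_divide_distrib)
  also have "\<dots> = (2 * of_real pi * \<i>) ^ (n + 2) * (w * poly (eulerian n) w / (1 - w) ^ (n + 2)) / fact (Suc n)"
    unfolding Polygamma_reflection[OF c] by (simp only: Let_def w_def c_def)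
  also have "(2 * of_real pi * \<i>) ^ (n + 2) = (- 1) ^ m * (2 * of_real pi) ^ (2 * m)"
    unfolding n(1)[symmetric] power_mult_distrib by (simp add: power_mult)
  finally show ?thesis
    unfolding f_def n(2,3) n(1)[symmetric] by (simp only: times_divide_eq_left)
qed

text \<open>Scaling by h reduces the sum to \<open>has_sum_lattice_powers\<close> at h p. At a
  lattice point w = 1, and the zero of (1 - w)^(2m) agrees with the value 0 that
  \<open>symbol\<close> takes there.\<close>

lemma symbol_eq:
  fixes p h :: real
  assumes h: "h > 0" and m: "m \<ge> 1"
  defines "w \<equiv> exp (2 * of_real pi * \<i> * of_real h * of_real p)"
  shows "of_real (symbol m h p) =
    fact (2 * m - 1) / of_real h ^ (2 * m) * ((1 - w) ^ (2 * m) / (w * poly (eulerian (2 * m - 2)) w))"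
proof (cases "h * p \<in> \<int>")
  case True
  then obtain \<beta> :: int where \<beta>: "h * p = of_int \<beta>"
    by (auto elim: Ints_cases)
  then have "p = of_int \<beta> / h"
    using h by (simp add: field_simps)
  then have "symbol m h p = 0"
    unfolding symbol_def by auto
  moreover have "complex_of_real (h * p) \<in> \<int>"
    unfolding \<beta> by simp
  then have "w = 1"
    using exp_2pi_i_eq_1_iff[of "of_real (h * p)"] by (simp add: w_def mult.assoc)
  ultimately show ?thesis
    using m by simp
next
  case False
  have np: "\<not> (\<exists>\<beta>::int. p = of_int \<beta> / h)"
    using False h by auto
  define T where "T = (\<Sum>\<^sub>\<infinity>\<beta>::int. 1 / \<bar>h * p - of_int \<beta>\<bar> ^ (2 * m))"
  define V where "V = w * poly (eulerian (2 * m - 2)) w / (1 - w) ^ (2 * m)"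
  have hs: "((\<lambda>\<beta>::int. complex_of_real (1 / \<bar>h * p - of_int \<beta>\<bar> ^ (2 * m))) has_sum
    ((- 1) ^ m * (2 * of_real pi) ^ (2 * m) / fact (2 * m - 1) * V)) UNIV"
    using has_sum_lattice_powers[OF False m] by (simp only: w_def V_def of_real_mult mult.assoc)
  have "(\<lambda>\<beta>::int. 1 / \<bar>h * p - of_int \<beta>\<bar> ^ (2 * m)) summable_on UNIV"
    using summable_on_Re[OF has_sum_imp_summable[OF hs]] by (simp only: Re_complex_of_real)
  then have "((\<lambda>\<beta>::int. 1 / \<bar>h * p - of_int \<beta>\<bar> ^ (2 * m)) has_sum T) UNIV"
    unfolding T_def by (rule has_sum_infsum)
  then have "((\<lambda>\<beta>::int. complex_of_real (1 / \<bar>h * p - of_int \<beta>\<bar> ^ (2 * m))) has_sum of_real T) UNIV"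
    by (rule has_sum_of_real)
  with hs have T: "of_real T = (- 1) ^ m * (2 * of_real pi) ^ (2 * m) / fact (2 * m - 1) * V"
    using has_sum_unique by blast
  have "(\<Sum>\<^sub>\<infinity>\<beta>::int. 1 / \<bar>p - of_int \<beta> / h\<bar> ^ (2 * m)) = h ^ (2 * m) * T"
  proof -
    have "1 / \<bar>p - of_int \<beta> / h\<bar> ^ (2 * m) = h ^ (2 * m) * (1 / \<bar>h * p - of_int \<beta>\<bar> ^ (2 * m))" for \<beta> :: int
    proof -
      have "p - of_int \<beta> / h = (h * p - of_int \<beta>) / h"
        using h by (simp add: field_simps)
      then show ?thesis
        using h by (simp add: abs_divide power_divide)
    qed
    then show ?thesis
      unfolding T_def by (simp only: infsum_cmult_right')
  qed
  then have "complex_of_real (symbol m h p) =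
      inverse ((- 1) ^ m / (2 * of_real pi) ^ (2 * m) * (of_real h ^ (2 * m) * of_real T))"
    using np by (simp add: symbol_def)
  also have "\<dots> = fact (2 * m - 1) / of_real h ^ (2 * m) * inverse V"
  proof -
    \<comment> \<open>Here s is (-1)^m, its own inverse, and a is (2 pi)^(2m): the normalisation of
      the symbol cancels that of the lattice sum.\<close>
    have "inverse (s / a * (b * (s * a / f * v))) = f / b * inverse v"
      if s: "s * s = 1" and a: "a \<noteq> 0" for s a b f v :: complex
    proof -
      have "s / a * (b * (s * a / f * v)) = (s * s) * (a / a) * (b / f * v)"
        by simp
      also have "\<dots> = b / f * v"
        unfolding s using a by simp
      finally have eq: "s / a * (b * (s * a / f * v)) = b / f * v" .
      show ?thesis unfolding eq by (simp add: divide_inverse)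
    qed
    then show ?thesis
      unfolding T by this simp_all
  qed
  finally show ?thesis
    by (simp add: V_def inverse_eq_divide)
qed

subsection \<open>Differences of truncated powers\<close>

text \<open>Meant for indices from -m to m only: below -m the truncation by \<open>nat\<close> makes
  the value 1.\<close>

definition diff_coeff :: "nat \<Rightarrow> int \<Rightarrow> complex" where
  "diff_coeff m k = (- 1) ^ nat (k + int m) * of_nat ((2 * m) choose nat (int m + k))"

lemma sum_diff_coeff:
  "(\<Sum>k = - int m..int m. diff_coeff m k * f k) =
   (\<Sum>i\<le>2 * m. (- 1) ^ i * of_nat ((2 * m) choose i) * f (int i - int m))"
  by (rule sum.reindex_bij_witness[of _ "\<lambda>i. int i - int m" "\<lambda>k. nat (k + int m)"])
    (auto simp: diff_coeff_def add.commute)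

lemma conv_sym_diff2:
  "conv (sym_diff2 m) f \<beta> = (\<Sum>k = - int m..int m. diff_coeff m k * f (\<beta> - k))"
proof -
  have sd: "sym_diff2 m \<gamma> = (if \<gamma> \<in> {- int m..int m} then diff_coeff m \<gamma> else 0)" for \<gamma>
  proof -
    have "sym_diff2 m \<gamma> = (\<Sum>k = - int m..int m. if k = \<gamma> then diff_coeff m k else 0)"
      unfolding sym_diff2_def diff_coeff_def delta_def by (intro sum.cong) auto
    then show ?thesis by simp
  qed
  have "conv (sym_diff2 m) f \<beta> = (\<Sum>\<^sub>\<infinity>\<gamma>\<in>{- int m..int m}. diff_coeff m \<gamma> * f (\<beta> - \<gamma>))"
    unfolding conv_def by (rule infsum_cong_neutral) (auto simp: sd)
  then show ?thesis by simp
qed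

text \<open>The symbol of the symmetric difference, by the binomial theorem after the shift k = i -
  m.\<close>

lemma sum_diff_coeff_powi:
  assumes z: "z \<noteq> 0"
  shows "(\<Sum>k = - int m..int m. diff_coeff m k * z powi k) = (1 - z) ^ (2 * m) / z ^ m"
proof -
  have "(1 - z) ^ (2 * m) = (\<Sum>i\<le>2 * m. of_nat ((2 * m) choose i) * (- z) ^ i)"
    using binomial_ring[of "- z" 1 "2 * m"] by simp
  also have "\<dots> / z ^ m = (\<Sum>i\<le>2 * m. (- 1) ^ i * of_nat ((2 * m) choose i) * z powi (int i - int m))"
    unfolding sum_divide_distrib using z
    by (intro sum.cong) (auto simp: power_int_diff power_minus[of z] field_simps)
  finally show ?thesis
    unfolding sum_diff_coeff by simp
qed

text \<open>Up to normalisation these are the values of the cardinal B-spline at the integers: by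
  \<open>fps_eulerian\<close> the Euler polynomial is $(1-\lambda)^{2m}$ times the generating function of the
  powers $n^{2m-1}$.\<close>

lemma diff_truncated_power:
  assumes m: "m \<ge> 1"
  shows "(\<Sum>i\<le>2 * m. (- 1) ^ i * of_nat ((2 * m) choose i) *
      (if int i \<le> x then (of_int x - of_nat i) ^ (2 * m - 1) else 0)) =
    (if x \<ge> 1 then coeff (eulerian (2 * m - 2)) (nat (x - 1)) else 0)"
proof (cases "x \<ge> 0")
  case False
  then show ?thesis by (auto intro!: sum.neutral)
next
  case True
  then obtain n where n: "x = int n"
    using nonneg_int_cases by blast
  define F where "F = Abs_fps (\<lambda>n. of_nat n ^ (2 * m - 1) :: complex)"
  have eq: "fps_X * fps_of_poly (eulerian (2 * m - 2)) = (1 - fps_X) ^ (2 * m) * F"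
  proof -
    have "2 * m - 2 + 2 = 2 * m" "Suc (2 * m - 2) = 2 * m - 1" using m by auto
    with fps_eulerian[of "2 * m - 2"] show ?thesis by (simp only: F_def)
  qed
  have "(1 - fps_X) ^ (2 * m) = (\<Sum>i\<le>2 * m. of_nat ((2 * m) choose i) * (- fps_X) ^ i :: complex fps)"
    using binomial_ring[of "- fps_X :: complex fps" 1 "2 * m"] by simp
  also have "\<dots> = (\<Sum>i\<le>2 * m. fps_const ((- 1) ^ i * of_nat ((2 * m) choose i)) * fps_X ^ i)"
    by (intro sum.cong) (auto simp: power_minus[of fps_X] fps_of_nat[symmetric] mult_ac
        simp flip: fps_const_mult fps_const_power fps_const_neg)
  finally have "fps_nth ((1 - fps_X) ^ (2 * m) * F) n =
      (\<Sum>i\<le>2 * m. (- 1) ^ i * of_nat ((2 * m) choose i) * (if n < i then 0 else of_nat (n - i) ^ (2 * m - 1)))"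
    by (simp add: sum_distrib_right fps_sum_nth mult.assoc fps_X_power_mult_nth F_def del: fps_const_mult cong: if_cong)
  also have "\<dots> = (\<Sum>i\<le>2 * m. (- 1) ^ i * of_nat ((2 * m) choose i) *
      (if int i \<le> x then (of_int x - of_nat i) ^ (2 * m - 1) else 0))"
    unfolding n by (intro sum.cong) (auto simp: of_nat_diff)
  finally show ?thesis
    unfolding eq[symmetric] n by (auto simp: nat_diff_distrib)
qed

text \<open>A difference of order 2m annihilates degree 2m - 1. As a polynomial in y it vanishes at
  all integers n \<ge> 2m: there no power is truncated, and the index n - 1 exceeds the degree of
  the Euler polynomial.\<close>

lemma diff_power_eq_0:
  assumes m: "m \<ge> 1"
  shows "(\<Sum>i\<le>2 * m. (- 1) ^ i * of_nat ((2 * m) choose i) * (y - of_nat i) ^ (2 * m - 1)) = (0::complex)"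
proof -
  define q :: "complex poly" where
    "q = (\<Sum>i\<le>2 * m. smult ((- 1) ^ i * of_nat ((2 * m) choose i)) ([:- of_nat i, 1:] ^ (2 * m - 1)))"
  have q: "poly q y = (\<Sum>i\<le>2 * m. (- 1) ^ i * of_nat ((2 * m) choose i) * (y - of_nat i) ^ (2 * m - 1))" for y
    by (simp add: q_def poly_sum poly_power)
  have "q = 0"
  proof (rule poly_eqI_infinite[of "of_nat ` {2 * m..}"])
    show "infinite (of_nat ` {2 * m..} :: complex set)"
      by (simp add: finite_image_iff inj_on_def infinite_Ici)
    fix y :: complex assume "y \<in> of_nat ` {2 * m..}"
    then obtain n where n: "y = of_nat n" "n \<ge> 2 * m" by auto
    have "poly q y = (\<Sum>i\<le>2 * m. (- 1) ^ i * of_nat ((2 * m) choose i) *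
      (if int i \<le> int n then (of_int (int n) - of_nat i) ^ (2 * m - 1) else 0))"
      unfolding q using n by (intro sum.cong) auto
    also have "\<dots> = 0"
      unfolding diff_truncated_power[OF m] using n m by (auto intro: coeff_eulerian_eq_0)
    finally show "poly q y = poly 0 y" by simp
  qed
  then show ?thesis using q[of y] by simp
qed

text \<open>Half of x^(2m-1) sgn(x) is the truncated power minus x^(2m-1)/2. The difference
  annihilates the second part and turns the first into coefficients of the Euler polynomial.\<close>

lemma sum_diff_coeff_G:
  assumes m: "m \<ge> 1" and h: "h > 0"
  shows "(\<Sum>k = - int m..int m. diff_coeff m k * G m h (\<beta> - k)) =
    of_real h ^ (2 * m - 1) / fact (2 * m - 1) *
      (if \<beta> + int m \<ge> 1 then coeff (eulerian (2 * m - 2)) (nat (\<beta> + int m - 1)) else 0)"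
proof -
  define x where "x = \<beta> + int m"
  define c :: complex where "c = of_real h ^ (2 * m - 1) / fact (2 * m - 1)"
  have G: "G m h (\<beta> - (int i - int m)) = c * ((if int i \<le> x then (of_int x - of_nat i) ^ (2 * m - 1) else 0)
      - (of_int x - of_nat i) ^ (2 * m - 1) / 2)" for i
  proof -
    have y: "\<beta> - (int i - int m) = x - int i" by (simp add: x_def)
    \<comment> \<open>A positive exponent makes the truncated power vanish at
      \<open>x = int i\<close>, in agreement with \<open>sgn 0 = 0\<close>.\<close>
    have odd: "2 * m - 1 \<noteq> 0" using m by auto
    have sgn: "sgn (h * of_int (x - int i)) = (if x = int i then 0 else if int i \<le> x then 1 else - 1)"
      using h by (auto simp: sgn_if zero_less_mult_iff)
    then show ?thesis
      unfolding y G_def c_def sgn power_mult_distrib using odd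
      by (auto simp: power_0_left)
  qed
  have "(\<Sum>k = - int m..int m. diff_coeff m k * G m h (\<beta> - k)) =
    c * ((\<Sum>i\<le>2 * m. (- 1) ^ i * of_nat ((2 * m) choose i) * (if int i \<le> x then (of_int x - of_nat i) ^ (2 * m - 1) else 0))
      - (\<Sum>i\<le>2 * m. (- 1) ^ i * of_nat ((2 * m) choose i) * (of_int x - of_nat i) ^ (2 * m - 1)) / 2)"
    unfolding sum_diff_coeff G
    by (simp add: sum_distrib_left sum_subtractf[symmetric] sum_divide_distrib right_diff_distrib mult_ac)
  then show ?thesis
    unfolding diff_truncated_power[OF m] diff_power_eq_0[OF m] by (simp add: c_def x_def)
qed

subsection \<open>The discrete analogue\<close>

context euler_roots
begin

text \<open>On the Fourier side this is E(z) z^(1-m) times z^(m-1) / E(z), which is 1, the series of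
  \<open>delta\<close>.\<close>

lemma convolve_S_E:
  "(\<Sum>j\<le>2 * m - 2. coeff E j * S (\<beta> + int m - 1 - int j)) = delta \<beta>"
proof -
  have "(\<lambda>\<beta>. \<Sum>j\<le>2 * m - 2. coeff E j * S (\<beta> + int m - 1 - int j)) = delta"
  proof (rule Fourier_coeffs_unique[where f = "\<lambda>_. 1"])
    fix z :: complex assume z: "norm z = 1"
    have z0: "z \<noteq> 0" using z by auto
    have "((\<lambda>\<gamma>. \<Sum>j\<le>2 * m - 2. coeff E j * (S (\<gamma> - (int j - (int m - 1))) * z powi \<gamma>)) has_sum
        (\<Sum>j\<le>2 * m - 2. coeff E j * (z powi (int j - (int m - 1)) * (z ^ (m - 1) / poly E z)))) UNIV"
      by (intro has_sum_sum has_sum_cmult_right has_sum_shift_powi[OF has_sum_S_circle[OF z] z0]) auto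
    also have "(\<Sum>j\<le>2 * m - 2. coeff E j * (z powi (int j - (int m - 1)) * (z ^ (m - 1) / poly E z)))
       = (\<Sum>j\<le>2 * m - 2. coeff E j * z ^ j) / poly E z"
    proof -
      have "z powi (int j - (int m - 1)) * (z ^ (m - 1) / poly E z) = z ^ j / poly E z" for j
      proof -
        have "z powi (int j - (int m - 1)) = z powi (int j - int (m - 1))"
          using m by (intro arg_cong[where f = "\<lambda>k. z powi k"]) auto
        also have "\<dots> = z ^ j / z ^ (m - 1)"
          using z0 by (simp only: power_int_diff power_int_of_nat simp_thms)
        finally show ?thesis using z0 by simp
      qed
      then show ?thesis
        by (simp only: sum_divide_distrib times_divide_eq_right)
    qed
    also have "\<dots> = 1"
    proof -
      have "poly E z = (\<Sum>j\<le>2 * m - 2. coeff E j * z ^ j)"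
        unfolding poly_altdef degree_eulerian ..
      then show ?thesis using E_nonzero_circle[OF z] by simp
    qed
    finally have "((\<lambda>\<gamma>. \<Sum>j\<le>2 * m - 2. coeff E j * (S (\<gamma> - (int j - (int m - 1))) * z powi \<gamma>)) has_sum 1) UNIV" .
    moreover have "\<gamma> - (int j - (int m - 1)) = \<gamma> + int m - 1 - int j" for \<gamma> j
      by simp
    ultimately show "((\<lambda>\<beta>. (\<Sum>j\<le>2 * m - 2. coeff E j * S (\<beta> + int m - 1 - int j)) * z powi \<beta>) has_sum 1) UNIV"
      by (simp only: sum_distrib_right mult.assoc)
    show "((\<lambda>\<beta>. delta \<beta> * z powi \<beta>) has_sum 1) UNIV"
      by (rule has_sum_finite_neutralI[of "{0}"]) (auto simp: delta_def)
  qed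
  then show ?thesis by (rule fun_cong)
qed

text \<open>\<open>S\<close> is a finite combination of geometric sequences, while \<open>G\<close>
  is bounded by a power of the sum of |x| and |\<gamma>|.\<close>

lemma summable_S_G: "(\<lambda>\<gamma>. S \<gamma> * G m h (x - \<gamma>)) summable_on UNIV"
proof -
  define C where "C = \<bar>h\<bar> ^ (2 * m - 1)"
  have G: "norm (G m h (x - \<gamma>)) \<le> C * (real (nat \<bar>x\<bar>) + real_of_int \<bar>\<gamma>\<bar>) ^ (2 * m - 1)" for \<gamma>
  proof -
    have "norm (G m h (x - \<gamma>)) =
        (C * \<bar>real_of_int (x - \<gamma>)\<bar> ^ (2 * m - 1)) * (\<bar>sgn (h * of_int (x - \<gamma>))\<bar> / (2 * fact (2 * m - 1)))"
      unfolding G_def C_def norm_of_real by (simp add: abs_mult power_abs power_mult_distrib abs_divide)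
    also have "\<dots> \<le> (C * \<bar>real_of_int (x - \<gamma>)\<bar> ^ (2 * m - 1)) * 1"
    proof (intro mult_left_mono)
      have "(1::real) \<le> 2 * fact (2 * m - 1)"
        using fact_ge_1[of "2 * m - 1", where 'a = real] by linarith
      then show "\<bar>sgn (h * of_int (x - \<gamma>))\<bar> / (2 * fact (2 * m - 1)) \<le> 1"
        by (simp add: sgn_if)
    qed (simp add: C_def)
    also have "\<dots> \<le> C * (real (nat \<bar>x\<bar>) + real_of_int \<bar>\<gamma>\<bar>) ^ (2 * m - 1)"
      unfolding mult_1_right by (intro mult_left_mono power_mono) (auto simp: C_def)
    finally show ?thesis .
  qed
  have "(\<lambda>\<gamma>. \<Sum>k = 1..m - 1. lam k ^ (m - 2) / poly (pderiv E) (lam k) * (lam k ^ nat \<bar>\<gamma>\<bar> * G m h (x - \<gamma>)))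
      summable_on UNIV"
    by (intro summable_on_sum summable_on_cmult_right summable_polynomial_geometric_int[OF _ _ G] lam_root(2))
      (auto simp: C_def)
  then show ?thesis
    by (simp add: S_eq sum_distrib_right mult.assoc)
qed

definition D :: "real \<Rightarrow> int \<Rightarrow> complex" where
  "D h \<beta> = fact (2 * m - 1) / of_real h ^ (2 * m) * conv (sym_diff2 m) S \<beta>"

lemma D_eq: "D h \<beta> = fact (2 * m - 1) / of_real h ^ (2 * m) *
    (\<Sum>k = - int m..int m. diff_coeff m k * S (\<beta> - k))"
  by (simp add: D_def conv_sym_diff2)

text \<open>The difference is moved from \<open>S\<close> to \<open>G\<close>, where it yields a
  multiple of the coefficients of \<open>E\<close>, and \<open>convolve_S_E\<close> applies. Only
  finite sums are interchanged with the infinite one.\<close>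

lemma has_sum_diff_S_G:
  assumes h: "h > 0"
  shows "((\<lambda>\<gamma>. (\<Sum>k = - int m..int m. diff_coeff m k * S (\<gamma> - k)) * G m h (\<beta> - \<gamma>)) has_sum
    (of_real h ^ (2 * m - 1) / fact (2 * m - 1) * delta \<beta>)) UNIV"
proof -
  \<comment> \<open>The convolution of \<open>S\<close> and \<open>G\<close> is never evaluated:
    both placements of the difference lead to the same combination of its shifted values.\<close>
  define V where "V = (\<lambda>x. \<Sum>\<^sub>\<infinity>\<gamma>. S \<gamma> * G m h (x - \<gamma>))"
  have V: "((\<lambda>\<gamma>. S \<gamma> * G m h (x - \<gamma>)) has_sum V x) UNIV" for x
    unfolding V_def by (intro has_sum_infsum summable_S_G)
  have "((\<lambda>\<gamma>. S (\<gamma> - k) * G m h (\<beta> - \<gamma>)) has_sum V (\<beta> - k)) UNIV" for k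
  proof -
    have "((\<lambda>\<gamma>. S (\<gamma> + - k) * G m h (\<beta> - k - (\<gamma> + - k))) has_sum V (\<beta> - k)) UNIV"
      using V by (subst has_sum_int_shift)
    then show ?thesis by simp
  qed
  then have "((\<lambda>\<gamma>. \<Sum>k = - int m..int m. diff_coeff m k * (S (\<gamma> - k) * G m h (\<beta> - \<gamma>))) has_sum
      (\<Sum>k = - int m..int m. diff_coeff m k * V (\<beta> - k))) UNIV"
    by (intro has_sum_sum has_sum_cmult_right) auto
  also have "(\<Sum>k = - int m..int m. diff_coeff m k * V (\<beta> - k))
      = of_real h ^ (2 * m - 1) / fact (2 * m - 1) * delta \<beta>"
  proof -
    define \<kappa> :: complex where "\<kappa> = of_real h ^ (2 * m - 1) / fact (2 * m - 1)"
    define e where "e = (\<lambda>j. if j \<ge> 0 then coeff E (nat j) else 0)"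
    have "((\<lambda>\<gamma>. \<Sum>k = - int m..int m. diff_coeff m k * (S \<gamma> * G m h (\<beta> - k - \<gamma>))) has_sum
        (\<Sum>k = - int m..int m. diff_coeff m k * V (\<beta> - k))) UNIV"
      by (intro has_sum_sum has_sum_cmult_right V) auto
    moreover have "(\<Sum>k = - int m..int m. diff_coeff m k * (S \<gamma> * G m h (\<beta> - k - \<gamma>)))
        = S \<gamma> * (\<kappa> * e (\<beta> + int m - 1 - \<gamma>))" for \<gamma>
    proof -
      have "(\<Sum>k = - int m..int m. diff_coeff m k * (S \<gamma> * G m h (\<beta> - k - \<gamma>)))
         = S \<gamma> * (\<Sum>k = - int m..int m. diff_coeff m k * G m h (\<beta> - \<gamma> - k))"
        by (simp add: sum_distrib_left algebra_simps)
      also have "\<dots> = S \<gamma> * (\<kappa> * e (\<beta> + int m - 1 - \<gamma>))"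
        using m h by (subst sum_diff_coeff_G) (auto simp: \<kappa>_def e_def algebra_simps)
      finally show ?thesis .
    qed
    ultimately have "((\<lambda>\<gamma>. S \<gamma> * (\<kappa> * e (\<beta> + int m - 1 - \<gamma>))) has_sum
        (\<Sum>k = - int m..int m. diff_coeff m k * V (\<beta> - k))) UNIV"
      by simp
    \<comment> \<open>The substitution \<gamma> = \<beta> + m - 1 - j evaluates \<open>e\<close> at
      j, which confines the sum to 0 \<le> j \<le> 2m - 2.\<close>
    then have "((\<lambda>j. S (\<beta> + int m - 1 - j) * (\<kappa> * e (\<beta> + int m - 1 - (\<beta> + int m - 1 - j)))) has_sum
        (\<Sum>k = - int m..int m. diff_coeff m k * V (\<beta> - k))) UNIV"
      by (subst has_sum_int_reflect)
    then have 1: "((\<lambda>j. S (\<beta> + int m - 1 - j) * (\<kappa> * e j)) has_sum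
        (\<Sum>k = - int m..int m. diff_coeff m k * V (\<beta> - k))) UNIV"
      by simp
    have "(\<Sum>j\<in>int ` {..2 * m - 2}. S (\<beta> + int m - 1 - j) * (\<kappa> * e j))
        = \<kappa> * (\<Sum>j\<le>2 * m - 2. coeff E j * S (\<beta> + int m - 1 - int j))"
      by (subst sum.reindex) (auto simp: e_def sum_distrib_left mult_ac)
    also have "\<dots> = \<kappa> * delta \<beta>"
      by (simp only: convolve_S_E)
    finally have "((\<lambda>j. S (\<beta> + int m - 1 - j) * (\<kappa> * e j)) has_sum (\<kappa> * delta \<beta>)) UNIV"
    proof (intro has_sum_finite_neutralI[of "int ` {..2 * m - 2}"])
      fix j assume "j \<in> UNIV - int ` {..2 * m - 2}"
      then have "j < 0 \<or> nat j > 2 * m - 2"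
        by (metis DiffE atMost_iff image_eqI linorder_not_le nat_0_le)
      then show "S (\<beta> + int m - 1 - j) * (\<kappa> * e j) = 0"
        by (auto simp: e_def coeff_eulerian_eq_0)
    qed auto
    with 1 show ?thesis
      unfolding \<kappa>_def using has_sum_unique by blast
  qed
  finally show ?thesis
    by (simp add: sum_distrib_right mult.assoc)
qed

text \<open>The constant (2m-1)!/h^(2m) meets h^(2m-1)/(2m-1)! and leaves the 1/h of the convolution
  equation. The Fourier clause is the product of the symbols of the difference and of
  \<open>S\<close>, compared with \<open>symbol_eq\<close>.\<close>

lemma is_discrete_analogue_D:
  assumes h: "h > 0"
  shows "is_discrete_analogue m h (D h)"
  unfolding is_discrete_analogue_def
proof (intro conjI allI)
  define c :: complex where "c = fact (2 * m - 1) / of_real h ^ (2 * m)"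
  have conv: "((\<lambda>\<gamma>. D h \<gamma> * G m h (\<beta> - \<gamma>)) has_sum (inverse (of_real h) * delta \<beta>)) UNIV" for \<beta>
  proof -
    have "c * (of_real h ^ (2 * m - 1) / fact (2 * m - 1) * delta \<beta>) = inverse (of_real h) * delta \<beta>"
    proof -
      obtain n where n: "2 * m = Suc n" "2 * m - 1 = n"
        using m by (intro that[of "2 * m - 1"]) auto
      show ?thesis
        unfolding c_def n using h by (simp add: field_simps)
    qed
    then show ?thesis
      using has_sum_cmult_right[OF has_sum_diff_S_G[OF h, of \<beta>], of c]
      by (simp add: D_eq c_def mult.assoc)
  qed
  fix \<beta>
  show "(\<lambda>\<gamma>. D h \<gamma> * G m h (\<beta> - \<gamma>)) summable_on UNIV"
    using conv by (rule has_sum_imp_summable)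
  show "of_real h * conv (D h) (G m h) \<beta> = delta \<beta>"
    unfolding conv_def infsumI[OF conv] using h by simp
next
  fix p :: real
  define w where "w = exp (2 * of_real pi * \<i> * of_real h * of_real p)"
  have w: "norm w = 1" "w \<noteq> 0"
    by (auto simp: w_def norm_exp_eq_Re)
  have "((\<lambda>\<gamma>. \<Sum>k = - int m..int m. diff_coeff m k * (S (\<gamma> - k) * w powi \<gamma>)) has_sum
      (\<Sum>k = - int m..int m. diff_coeff m k * (w powi k * (w ^ (m - 1) / poly E w)))) UNIV"
    by (intro has_sum_sum has_sum_cmult_right has_sum_shift_powi[OF has_sum_S_circle[OF w(1)] w(2)]) auto
  also have "(\<Sum>k = - int m..int m. diff_coeff m k * (w powi k * (w ^ (m - 1) / poly E w)))
      = (\<Sum>k = - int m..int m. diff_coeff m k * w powi k) * (w ^ (m - 1) / poly E w)"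
    by (simp only: sum_distrib_right mult.assoc)
  also have "\<dots> = (1 - w) ^ (2 * m) / (w * poly E w)"
  proof -
    have "w ^ m = w * w ^ (m - 1)"
      using m by (cases m) auto
    then show ?thesis
      unfolding sum_diff_coeff_powi[OF w(2)] using w(2) by simp
  qed
  finally have sum: "((\<lambda>\<gamma>. \<Sum>k = - int m..int m. diff_coeff m k * (S (\<gamma> - k) * w powi \<gamma>)) has_sum
      ((1 - w) ^ (2 * m) / (w * poly E w))) UNIV" .
  have "of_real (symbol m h p) = fact (2 * m - 1) / of_real h ^ (2 * m) * ((1 - w) ^ (2 * m) / (w * poly E w))"
    unfolding w_def using m by (intro symbol_eq[OF h]) simp
  then have "((\<lambda>\<gamma>. D h \<gamma> * w powi \<gamma>) has_sum of_real (symbol m h p)) UNIV"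
    using has_sum_cmult_right[OF sum, of "fact (2 * m - 1) / of_real h ^ (2 * m)"]
    by (simp only: D_eq sum_distrib_right mult.assoc)
  moreover have "w powi \<gamma> = exp (2 * of_real pi * \<i> * of_real h * of_int \<gamma> * of_real p)" for \<gamma>
    by (simp add: w_def exp_power_int mult_ac)
  ultimately show "((\<lambda>\<beta>. D h \<beta> * exp (2 * of_real pi * \<i> * of_real h * of_int \<beta> * of_real p))
      has_sum of_real (symbol m h p)) UNIV"
    by simp
qed

end

text \<open>Every z on the unit circle is exp(2 pi i h p) with p = Arg z / (2 pi h), so the Fourier
  clause prescribes the series of both candidates on the whole circle.\<close>

lemma is_discrete_analogue_unique:
  assumes h: "h > 0" and D: "is_discrete_analogue m h D" "is_discrete_analogue m h D'"
  shows "D = D'"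
proof (rule Fourier_coeffs_unique)
  define p where "p = (\<lambda>z. Arg z / (2 * pi * h))"
  have *: "((\<lambda>\<gamma>. D \<gamma> * z powi \<gamma>) has_sum of_real (symbol m h (p z))) UNIV"
    if D: "is_discrete_analogue m h D" and z: "norm z = 1" for D z
  proof -
    have eq: "z = exp (2 * of_real pi * \<i> * of_real h * of_real (p z))" (is "_ = exp ?t")
    proof -
      have "z \<noteq> 0" using z by auto
      from Arg_eq[OF this] have "z = exp (\<i> * of_real (Arg z))"
        unfolding z of_real_1 mult_1_left .
      also have "\<i> * of_real (Arg z) = 2 * of_real pi * \<i> * of_real h * of_real (p z)"
        using h by (simp add: p_def)
      finally show ?thesis .
    qed
    have "z powi \<gamma> = exp (2 * of_real pi * \<i> * of_real h * of_int \<gamma> * of_real (p z))" for \<gamma>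
    proof -
      have "z powi \<gamma> = exp ?t powi \<gamma>"
        by (rule arg_cong[OF eq])
      then show ?thesis by (simp add: exp_power_int mult_ac)
    qed
    then show ?thesis
      using D unfolding is_discrete_analogue_def by simp
  qed
  show "((\<lambda>\<gamma>. D \<gamma> * z powi \<gamma>) has_sum of_real (symbol m h (p z))) UNIV"
       "((\<lambda>\<gamma>. D' \<gamma> * z powi \<gamma>) has_sum of_real (symbol m h (p z))) UNIV" if "norm z = 1" for z
    using * D that by blast+
qed

theorem mainTheorem2:
  fixes m :: nat and h :: real and lam :: "nat \<Rightarrow> complex" and \<beta> :: int
  assumes "m \<ge> 2"
    and "h > 0"
    and "bij_betw lam {1..m - 1} {z. poly (euler_poly (2 * m - 2)) z = 0 \<and> norm z < 1}"
  shows "discrete_analogue m h \<beta> =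
    fact (2 * m - 1) / of_real h ^ (2 * m) *
      conv (sym_diff2 m)
        (\<lambda>\<gamma>. \<Sum>k = 1..m - 1. lam k powi (\<bar>\<gamma>\<bar> + int m - 2) /
               poly (pderiv (euler_poly (2 * m - 2))) (lam k)) \<beta>"
proof -
  interpret euler_roots m lam
    using assms by unfold_locales (simp_all add: euler_poly_eq_eulerian)
  have "discrete_analogue m h = D h"
    unfolding discrete_analogue_def
    using is_discrete_analogue_D is_discrete_analogue_unique assms(2) by blast
  then show ?thesis
    by (simp add: D_def S_def[abs_def] euler_poly_eq_eulerian)
qed

end
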